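(* Let $n\in\mathbb N$ and let $\mathcal P=(P_1,\dots,P_n)$ be an $H^2$-MSF polygonal, with $P_j=(2^{-\lambda_j},2^{-\lambda_j}m_j)$ and associated numbers $a_0<a_1<\dots<a_n=a_0+1$. Let $I_j=[a_{j-1},a_j]+m_j$ for $j=1,2,\dots,n$. Then $K=I_1\cup\dots\cup I_n$ is an $H^2$-wavelet set and it is the disjoint union of $n$ intervals. Moreover, writing $K(\mathcal P)$ for the $H^2$-wavelet set obtained in this way from $\mathcal P$, if $\mathcal P_1\ne\mathcal P_2$ are different $H^2$-MSF polygonals, then $K(\mathcal P_1)\ne K(\mathcal P_2)$.
   Context: Notation: $\mathbb N_0=\{0,1,2,\dots\}$, $\mathbb R^+=(0,\infty)$. Fourier transform: $\widehat f(\xi)=\int_{\mathbb R}f(x)e^{-2\pi i x\xi}\,dx$. $H^2(\mathbb R)=\{f\in L^2(\mathbb R):\widehat f(\xi)=0\text{ for a.e. }\xi\le 0\}$. A function $\psi\in H^2(\mathbb R)$ is an $H^2$-wavelet if $\{2^{j/2}\psi(2^j\cdot-k):j,k\in\mathbb Z\}$ is an orthonormal basis of $H^2(\mathbb R)$. A measurable set $K\subset\mathbb R^+$ is an $H^2$-wavelet set if there is an $H^2$-wavelet $\psi$ with $|\widehat\psi|=\chi_K$ a.e. For $\lambda\in\mathbb Z$ and $m\in\mathbb N_0$ let $P[\lambda,m]=(2^{-\lambda},2^{-\lambda}m)$. Let $P_j=P[\lambda_j,m_j]$, $j=1,\dots,n$, with $\lambda_j\in\mathbb Z$, $m_j\in\mathbb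 N_0$, $m_j\neq m_{j+1}$ for $1\le j\le n-1$, normalized by $\lambda_1=0$, $m_1=0$. Define $$a_0=-\frac{(m_n+1)2^{-(\lambda_n+1)}}{2^{-(\lambda_n+1)}-1},\qquad a_j=-\frac{m_j2^{-\lambda_j}-m_{j+1}2^{-\lambda_{j+1}}}{2^{-\lambda_j}-2^{-\lambda_{j+1}}}\ (j=1,\dots,n-1),\qquad a_n=a_0+1$$ (all denominators are required to be nonzero). The ordered sequence $\mathcal P=(P_1,\dots,P_n)$ is an $H^2$-MSF polygonal if $0<a_0<1$ and $a_0<a_1<\dots<a_n=a_0+1$. *)

theory Defs
  imports "HOL-Analysis.Analysis"
begin

section \<open>The space \<open>L\<^sup>2(\<real>)\<close> and the Fourier transform\<close>

text \<open>Elements of \<open>L\<^sup>2(\<real>)\<close> are represented by functions; everything below is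
  invariant under changes on null sets.\<close>

definition L2 :: "(real \<Rightarrow> complex) set" where
  "L2 = {f \<in> borel_measurable lebesgue. integrable lebesgue (\<lambda>x. (cmod (f x))\<^sup>2)}"

definition L2_inner :: "(real \<Rightarrow> complex) \<Rightarrow> (real \<Rightarrow> complex) \<Rightarrow> complex" where
  "L2_inner f g = (LINT x|lebesgue. f x * cnj (g x))"

text \<open>The squared distance is taken in the extended nonnegative reals, so that it is
  \<open>\<infinity>\<close>, not \<open>0\<close>, when the difference is not square integrable.\<close>

definition L2_dist_sq :: "(real \<Rightarrow> complex) \<Rightarrow> (real \<Rightarrow> complex) \<Rightarrow> ennreal" where
  "L2_dist_sq f g = (\<integral>\<^sup>+x. ennreal ((cmod (f x - g x))\<^sup>2) \<partial>lebesgue)"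

text \<open>For \<open>f\<close> in \<open>L\<^sup>2\<close> the integral of \<open>f(x) exp(-2 \<pi> \<i> x \<xi>)\<close> over the real line is
  understood as the limit in \<open>L\<^sup>2\<close> of the integrals over \<open>[-R, R]\<close>. As a
  transform is only determined almost everywhere, it is rendered as a relation
  between \<open>f\<close> and the representatives \<open>g\<close> of its transform.\<close>

definition truncated_fourier :: "(real \<Rightarrow> complex) \<Rightarrow> real \<Rightarrow> real \<Rightarrow> complex" where
  "truncated_fourier f R \<xi> = (LINT x:{-R..R}|lebesgue. f x * cis (- 2 * pi * x * \<xi>))"

definition has_fourier_transform :: "(real \<Rightarrow> complex) \<Rightarrow> (real \<Rightarrow> complex) \<Rightarrow> bool" where
  "has_fourier_transform f g \<longleftrightarrow>
     f \<in> L2 \<and> g \<in> L2 \<and> ((\<lambda>R. L2_dist_sq (truncated_fourier f R) g) \<longlongrightarrow> 0) at_top"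

definition H2 :: "(real \<Rightarrow> complex) set" where
  "H2 = {f \<in> L2. \<exists>g. has_fourier_transform f g \<and> (AE \<xi> in lebesgue. \<xi> \<le> 0 \<longrightarrow> g \<xi> = 0)}"

section \<open>Wavelets and wavelet sets\<close>

definition L2_orthonormal_basis ::
    "(real \<Rightarrow> complex) set \<Rightarrow> ('i \<Rightarrow> real \<Rightarrow> complex) \<Rightarrow> bool" where
  "L2_orthonormal_basis H e \<longleftrightarrow>
     (\<forall>i. e i \<in> H) \<and>
     (\<forall>i i'. L2_inner (e i) (e i') = (if i = i' then 1 else 0)) \<and>
     (\<forall>f\<in>H. \<forall>\<epsilon>>0. \<exists>F c. finite F \<and> L2_dist_sq f (\<lambda>x. \<Sum>i\<in>F. c i * e i x) < \<epsilon>)"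

definition dyadic_system :: "(real \<Rightarrow> complex) \<Rightarrow> int \<times> int \<Rightarrow> real \<Rightarrow> complex" where
  "dyadic_system \<psi> = (\<lambda>(j, k) x.
     complex_of_real (2 powr (real_of_int j / 2)) * \<psi> (2 powi j * x - real_of_int k))"

definition H2_wavelet :: "(real \<Rightarrow> complex) \<Rightarrow> bool" where
  "H2_wavelet \<psi> \<longleftrightarrow> \<psi> \<in> H2 \<and> L2_orthonormal_basis H2 (dyadic_system \<psi>)"

definition H2_wavelet_set :: "real set \<Rightarrow> bool" where
  "H2_wavelet_set K \<longleftrightarrow>
     K \<in> sets lebesgue \<and> K \<subseteq> {0<..} \<and>
     (\<exists>\<psi> g. H2_wavelet \<psi> \<and> has_fourier_transform \<psi> g \<and>
        (AE \<xi> in lebesgue. cmod (g \<xi>) = indicator K \<xi>))"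

section \<open>Polygonals\<close>

text \<open>A sequence of points \<open>P[\<lambda>\<^sub>1, m\<^sub>1], \<dots>, P[\<lambda>\<^sub>n, m\<^sub>n]\<close> is given by the list
  of its parameter pairs. Indices start at 1, as opposed to list positions.\<close>

definition grid_point :: "int \<times> nat \<Rightarrow> real \<times> real" where
  "grid_point = (\<lambda>(l, m). (2 powi (- l), 2 powi (- l) * real m))"

definition lam :: "(int \<times> nat) list \<Rightarrow> nat \<Rightarrow> int" where
  "lam p j = fst (p ! (j - 1))"

definition mul :: "(int \<times> nat) list \<Rightarrow> nat \<Rightarrow> nat" where
  "mul p j = snd (p ! (j - 1))"

definition first_knot :: "(int \<times> nat) list \<Rightarrow> real" where
  "first_knot p = (let n = length p in
     - ((real (mul p n) + 1) * 2 powi (- (lam p n + 1))) / (2 powi (- (lam p n + 1)) - 1))"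

definition knot :: "(int \<times> nat) list \<Rightarrow> nat \<Rightarrow> real" where
  "knot p j =
     (if j = 0 then first_knot p
      else if j = length p then first_knot p + 1
      else - (real (mul p j) * 2 powi (- lam p j) - real (mul p (j + 1)) * 2 powi (- lam p (j + 1)))
             / (2 powi (- lam p j) - 2 powi (- lam p (j + 1))))"

definition H2_MSF_polygonal :: "(int \<times> nat) list \<Rightarrow> bool" where
  "H2_MSF_polygonal p \<longleftrightarrow>
     (let n = length p in
      1 \<le> n \<and> lam p 1 = 0 \<and> mul p 1 = 0 \<and>
      (\<forall>j\<in>{1..<n}. mul p j \<noteq> mul p (j + 1)) \<and>
      (2::real) powi (- (lam p n + 1)) - 1 \<noteq> 0 \<and>
      (\<forall>j\<in>{1..<n}. (2::real) powi (- lam p j) - 2 powi (- lam p (j + 1)) \<noteq> 0) \<and>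
      0 < knot p 0 \<and> knot p 0 < 1 \<and>
      (\<forall>j<n. knot p j < knot p (j + 1)))"

definition polygonal_interval :: "(int \<times> nat) list \<Rightarrow> nat \<Rightarrow> real set" where
  "polygonal_interval p j = (\<lambda>x. x + real (mul p j)) ` {knot p (j - 1)..knot p j}"

definition polygonal_set :: "(int \<times> nat) list \<Rightarrow> real set" where
  "polygonal_set p = (\<Union>j\<in>{1..length p}. polygonal_interval p j)"

end

theory Submission
  imports Defs
begin

text \<open>The interval \<open>I\<^sub>j\<close> is a piece of \<open>[a\<^sub>0, a\<^sub>0 + 1]\<close> moved by the integer \<open>m\<^sub>j\<close>, so the set \<open>K\<close> of a
polygonal tiles the line under integer translations. The formulas for the knots say precisely
that \<open>2\<^bsup>-\<lambda>\<^sub>j\<^esup> I\<^sub>j\<close> ends where \<open>2\<^bsup>-\<lambda>\<^sub>j\<^sub>+\<^sub>1\<^esup> I\<^sub>j\<^sub>+\<^sub>1\<close> begins (the interior knots), and that the last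
of these scaled intervals ends at \<open>2 a\<^sub>0\<close> (the knot \<open>a\<^sub>0\<close>). Hence the scaled intervals fill
\<open>[a\<^sub>0, 2 a\<^sub>0]\<close>, and \<open>K\<close> tiles the half-line under dilations by powers of 2. Up to the finitely
many right endpoints both tilings are exact; the half-open version of \<open>K\<close> makes them exact.

A bounded set \<open>K\<close> with these two tilings is an \<open>H\<^sup>2\<close>-wavelet set. On the Fourier side the dyadic
system of the inverse transform \<open>\<psi>\<close> of the indicator of \<open>K\<close> consists of the functions
\<open>2\<^bsup>-j/2\<^esup> exp(-2\<pi>ik 2\<^bsup>-j\<^esup> \<xi>)\<close> restricted to \<open>2\<^sup>j K\<close>. For a fixed \<open>j\<close> the translation tiling turns these
into the exponentials on a period, which are a complete orthonormal system; different \<open>j\<close> live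
on disjoint sets that cover the half-line.

To transport this back through the Fourier transform three facts are needed: the transform, as
an \<open>L\<^sup>2\<close> limit of truncated integrals, is isometric (\<open>plancherel\<close>), it preserves inner products
(\<open>L2_inner_fourier_transform\<close>), and functions of compact support are the transforms of their
inverse Fourier integrals (\<open>fourier_inversion_compact_support\<close>). All rest on Parseval's identity
for Fourier series: if \<open>f\<close> lives on \<open>[0, 1)\<close>, then the values of its Fourier integral on
\<open>\<theta> + \<int>\<close> are the Fourier coefficients of \<open>f(x) exp(-2\<pi>i\<theta>x)\<close>, so the sum of their squares is the
squared norm of \<open>f\<close>, whatever \<open>\<theta>\<close> is; integrating over \<open>\<theta>\<close> gives Plancherel's theorem.

Closed intervals \<open>I\<^sub>i\<close>, \<open>I\<^sub>j\<close> cannot even touch: a common point would force either adjacent pieces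
with \<open>m\<^sub>j = m\<^sub>j\<^sub>+\<^sub>1\<close>, or \<open>a\<^sub>0 = a\<^sub>0 + 1 + m\<^sub>n\<close>. Finally \<open>K\<close> determines \<open>a\<^sub>0\<close> as its minimum, and then
piece by piece everything else: \<open>m\<^sub>j\<close> is the only integer that moves points of the \<open>j\<close>-th piece
into \<open>K\<close>, the next knot is the place where this integer changes, and \<open>\<lambda>\<^sub>j\<close> follows from the
chain of scaled intervals.\<close>

section \<open>Trigonometric sums\<close>

definition harmonic :: "real \<Rightarrow> complex" where
  "harmonic t = cis (2 * pi * t)"

lemma harmonic_0 [simp]: "harmonic 0 = 1"
  by (simp add: harmonic_def)

lemma harmonic_add: "harmonic (s + t) = harmonic s * harmonic t"
  by (simp add: harmonic_def cis_mult distrib_left)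

lemma cnj_harmonic [simp]: "cnj (harmonic t) = harmonic (- t)"
  by (simp add: harmonic_def cis_cnj)

lemma norm_harmonic [simp]: "cmod (harmonic t) = 1"
  by (simp add: harmonic_def)

lemma harmonic_of_int [simp]: "harmonic (of_int k) = 1"
  unfolding harmonic_def by (metis cis_multiple_2pi Ints_of_int)

lemma harmonic_add_int [simp]: "harmonic (t + of_int k) = harmonic t"
  by (simp add: harmonic_add)

lemma continuous_on_harmonic [continuous_intros]:
  "continuous_on S f \<Longrightarrow> continuous_on S (\<lambda>x. harmonic (f x))"
  unfolding harmonic_def by (intro continuous_intros)

lemma continuous_harmonic: "continuous_on UNIV harmonic"
  by (intro continuous_intros)

lemma borel_measurable_harmonic [measurable]: "harmonic \<in> borel_measurable borel"
  by (intro borel_measurable_continuous_onI continuous_harmonic)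

definition trig_sum :: "int set \<Rightarrow> (int \<Rightarrow> complex) \<Rightarrow> real \<Rightarrow> complex" where
  "trig_sum A c x = (\<Sum>k\<in>A. c k * harmonic (of_int k * x))"

lemma continuous_on_trig_sum: "continuous_on S (trig_sum A c)"
  unfolding trig_sum_def[abs_def] by (intro continuous_intros)

definition trig_polys :: "(real \<Rightarrow> complex) set" where
  "trig_polys = {trig_sum A c | A c. finite A}"

lemma trig_polys_const: "(\<lambda>x. a) \<in> trig_polys"
proof -
  have "(\<lambda>x. a) = trig_sum {0} (\<lambda>_. a)"
    by (auto simp: trig_sum_def)
  then show ?thesis unfolding trig_polys_def by blast
qed

lemma trig_polys_add:
  assumes "f \<in> trig_polys" "g \<in> trig_polys"
  shows "(\<lambda>x. f x + g x) \<in> trig_polys"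
proof -
  obtain A c B d where fin: "finite A" "finite B" and f: "f = trig_sum A c" and g: "g = trig_sum B d"
    using assms unfolding trig_polys_def by blast
  have "f x + g x = trig_sum (A \<union> B) (\<lambda>k. (if k \<in> A then c k else 0) + (if k \<in> B then d k else 0)) x" for x
  proof -
    have "f x = (\<Sum>k\<in>A\<union>B. (if k \<in> A then c k else 0) * harmonic (of_int k * x))"
      unfolding f trig_sum_def using fin by (intro sum.mono_neutral_cong_left) auto
    moreover have "g x = (\<Sum>k\<in>A\<union>B. (if k \<in> B then d k else 0) * harmonic (of_int k * x))"
      unfolding g trig_sum_def using fin by (intro sum.mono_neutral_cong_left) auto
    ultimately show ?thesis
      by (simp add: trig_sum_def sum.distrib[symmetric] distrib_right)
  qed
  then show ?thesis
    unfolding trig_polys_def using fin by (blast intro: finite_UnI)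
qed

lemma trig_polys_sum:
  assumes "finite I" "\<And>i. i \<in> I \<Longrightarrow> f i \<in> trig_polys"
  shows "(\<lambda>x. \<Sum>i\<in>I. f i x) \<in> trig_polys"
  using assms by (induction I rule: finite_induct) (auto intro: trig_polys_const trig_polys_add)

lemma trig_polys_harmonic: "(\<lambda>x. a * harmonic (of_int k * x)) \<in> trig_polys"
proof -
  have "(\<lambda>x. a * harmonic (of_int k * x)) = trig_sum {k} (\<lambda>_. a)"
    by (auto simp: trig_sum_def)
  then show ?thesis unfolding trig_polys_def by blast
qed

lemma trig_polys_mult:
  assumes "f \<in> trig_polys" "g \<in> trig_polys"
  shows "(\<lambda>x. f x * g x) \<in> trig_polys"
proof -
  obtain A c B d where fin: "finite A" "finite B" and f: "f = trig_sum A c" and g: "g = trig_sum B d"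
    using assms unfolding trig_polys_def by blast
  have "f x * g x = (\<Sum>k\<in>A. \<Sum>l\<in>B. (c k * d l) * harmonic (of_int (k + l) * x))" for x
    by (simp add: f g trig_sum_def sum_product harmonic_add ring_distribs mult_ac)
  then show ?thesis
    using fin by (auto intro!: trig_polys_sum trig_polys_harmonic simp del: of_int_add)
qed

text \<open>Along the circle a real linear functional is a combination of cosine and sine, hence of the
frequencies \<open>1\<close> and \<open>-1\<close>; trigonometric sums form an algebra, so polynomials follow.\<close>

lemma real_polynomial_function_on_circle:
  assumes "real_polynomial_function p"
  shows "(\<lambda>t. of_real (p (harmonic t))) \<in> trig_polys"
  using assms
proof (induction rule: real_polynomial_function.induct)
  case (linear h)
  then interpret bounded_linear h .
  have *: "of_real (h (harmonic t)) =
      ((of_real (h 1) - \<i> * of_real (h \<i>)) / 2) * harmonic (of_int 1 * t)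
    + ((of_real (h 1) + \<i> * of_real (h \<i>)) / 2) * harmonic (of_int (-1) * t)" for t
  proof -
    have "harmonic t = cos (2*pi*t) *\<^sub>R 1 + sin (2*pi*t) *\<^sub>R \<i>"
      by (simp add: harmonic_def complex_eq_iff)
    then have "h (harmonic t) = cos (2*pi*t) * h 1 + sin (2*pi*t) * h \<i>"
      by (simp only: add scaleR real_scaleR_def)
    then show ?thesis
      by (simp add: harmonic_def complex_eq_iff field_simps)
  qed
  show ?case unfolding *
    by (intro trig_polys_add trig_polys_harmonic)
next
  case (const c)
  then show ?case by (rule trig_polys_const)
next
  case (add f g)
  then show ?case by (simp add: trig_polys_add)
next
  case (mult f g)
  then show ?case by (simp add: trig_polys_mult)
qed

text \<open>The parametrisation of the circle by the compact interval is a closed map, hence a quotient map,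
and all that it identifies are the two endpoints.\<close>

lemma continuous_on_circle_factor:
  fixes h :: "real \<Rightarrow> complex"
  assumes "continuous_on {0..1} h" "h 0 = h 1"
  obtains k where "continuous_on (sphere 0 1) k" "\<And>t. t \<in> {0..1} \<Longrightarrow> k (harmonic t) = h t"
proof -
  have surj: "harmonic ` {0..1} = sphere 0 1"
  proof (intro equalityI subsetI)
    fix z :: complex assume "z \<in> sphere 0 1"
    then have "z = harmonic (Arg2pi z / (2*pi))"
      using Arg2pi_eq[of z] by (simp add: harmonic_def cis_conv_exp mult_ac)
    moreover have "Arg2pi z / (2*pi) \<in> {0..1}"
      using Arg2pi[of z] by (auto simp: field_simps)
    ultimately show "z \<in> harmonic ` {0..1}" by blast
  qed auto
  have inj: "h s = h t" if st01: "s \<in> {0..1}" "t \<in> {0..1}" "harmonic s = harmonic t" for s t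
  proof -
    obtain n :: int where n: "2*pi * s = 2*pi * t + 2*pi * of_int n"
      using st01(3) unfolding harmonic_def cis_conv_exp exp_eq
      by (auto simp: complex_eq_iff)
    then have "2*pi*(s - t - of_int n) = 0" by (simp add: algebra_simps)
    then have st: "s = t + of_int n" by simp
    then have "n = 0 \<or> n = 1 \<or> n = -1" using st01 by auto
    then show ?thesis using st01 st assms(2) by auto
  qed
  define k where "k z = h (SOME t. t \<in> {0..1} \<and> harmonic t = z)" for z
  have k: "k (harmonic t) = h t" if "t \<in> {0..1}" for t
    unfolding k_def by (rule someI2[of _ t]) (use that in \<open>auto intro: inj\<close>)
  have "continuous_on (sphere 0 1) k"
    unfolding continuous_on_closed_vimage[OF closed_sphere]
  proof (intro allI impI)
    fix C :: "complex set" assume "closed C"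
    have "closed (h -` C \<inter> {0..1})"
      using assms(1) \<open>closed C\<close> by (simp add: continuous_on_closed_vimage)
    then have "compact (h -` C \<inter> {0..1})"
      using bounded_subset[OF bounded_closed_interval[of 0 "1::real"]]
      by (simp add: compact_eq_bounded_closed)
    then have "compact (harmonic ` (h -` C \<inter> {0..1}))"
      by (intro compact_continuous_image continuous_intros) auto
    moreover have "harmonic ` (h -` C \<inter> {0..1}) = k -` C \<inter> sphere 0 1" (is "?L = ?R")
    proof (intro equalityI subsetI)
      fix z assume "z \<in> ?R"
      then obtain t where "t \<in> {0..1}" "z = harmonic t" "k z \<in> C"
        using surj by blast
      then show "z \<in> ?L" using k by auto
    qed (use k in auto)
    ultimately show "closed (k -` C \<inter> sphere 0 1)"
      by (simp add: compact_imp_closed)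
  qed
  with k that show ?thesis by blast
qed

text \<open>This is the Stone-Weierstrass theorem on the unit circle in the plane.\<close>

lemma trig_polys_uniformly_dense:
  fixes h :: "real \<Rightarrow> complex"
  assumes "continuous_on {0..1} h" "h 0 = h 1" "e > 0"
  obtains A c where "finite A" "\<And>t. t \<in> {0..1} \<Longrightarrow> cmod (h t - trig_sum A c t) < e"
proof -
  obtain k where k: "continuous_on (sphere 0 1) k" "\<And>t. t \<in> {0..1} \<Longrightarrow> k (harmonic t) = h t"
    using continuous_on_circle_factor[OF assms(1,2)] by blast
  obtain g where g: "polynomial_function g" "\<And>z. z \<in> sphere 0 1 \<Longrightarrow> cmod (k z - g z) < e"
    using Stone_Weierstrass_polynomial_function[OF compact_sphere k(1) assms(3)] by blast
  have re: "real_polynomial_function (\<lambda>z. Re (g z))" "real_polynomial_function (\<lambda>z. Im (g z))"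
    using g(1) unfolding polynomial_function_def o_def
    by (auto intro: bounded_linear_Re bounded_linear_Im)
  have "(\<lambda>t. of_real (Re (g (harmonic t))) + \<i> * of_real (Im (g (harmonic t)))) \<in> trig_polys"
    by (intro trig_polys_add trig_polys_mult trig_polys_const
        real_polynomial_function_on_circle[OF re(1)] real_polynomial_function_on_circle[OF re(2)])
  then have "(\<lambda>t. g (harmonic t)) \<in> trig_polys"
    by (simp add: complex_eq[symmetric])
  then obtain A c where "finite A" and Ac: "(\<lambda>t. g (harmonic t)) = trig_sum A c"
    unfolding trig_polys_def by blast
  have "cmod (h t - trig_sum A c t) < e" if "t \<in> {0..1}" for t
  proof -
    have "cmod (k (harmonic t) - g (harmonic t)) < e"
      by (rule g(2)) auto
    with that show ?thesis by (simp add: k(2) Ac[symmetric])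
  qed
  with \<open>finite A\<close> that show ?thesis by blast
qed

section \<open>Square integrals\<close>

text \<open>The squared \<open>L\<^sup>2\<close> norm. Its value may be infinite, so that estimates need no integrability.\<close>

definition energy :: "'a measure \<Rightarrow> ('a \<Rightarrow> complex) \<Rightarrow> ennreal" where
  "energy M f = (\<integral>\<^sup>+x. ennreal ((cmod (f x))\<^sup>2) \<partial>M)"

lemma L2_dist_sq_eq_energy: "L2_dist_sq f g = energy lebesgue (\<lambda>x. f x - g x)"
  by (simp add: L2_dist_sq_def energy_def)

lemma energy_cong_AE:
  assumes "AE x in M. cmod (f x) = cmod (g x)"
  shows "energy M f = energy M g"
  unfolding energy_def using assms by (intro nn_integral_cong_AE) auto

lemma energy_scale:
  assumes "f \<in> borel_measurable M"
  shows "energy M (\<lambda>x. c * f x) = ennreal ((cmod c)\<^sup>2) * energy M f"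
  unfolding energy_def using assms
  by (subst nn_integral_cmult[symmetric]) (auto simp: norm_mult power_mult_distrib ennreal_mult)

text \<open>A triangle inequality for squared norms. Letting the weight \<open>d\<close> tend to \<open>0\<close> shows that norms
converge along convergent sequences; \<open>d = 1\<close> gives rough estimates with factor 2.\<close>

lemma norm_square_le_weighted:
  fixes a b :: complex
  assumes "d > 0"
  shows "(cmod a)\<^sup>2 \<le> (1 + d) * (cmod b)\<^sup>2 + (1 + 1/d) * (cmod (a - b))\<^sup>2"
proof -
  have "cmod a \<le> cmod b + cmod (a - b)"
    using norm_triangle_ineq[of b "a - b"] by simp
  then have "(cmod a)\<^sup>2 \<le> (cmod b + cmod (a - b))\<^sup>2"
    by (intro power_mono) auto
  also have "\<dots> \<le> (1 + d) * (cmod b)\<^sup>2 + (1 + 1/d) * (cmod (a - b))\<^sup>2"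
  proof -
    have "0 \<le> (d * cmod b - cmod (a - b))\<^sup>2 / d" using assms by simp
    also have "\<dots> = (1 + d) * (cmod b)\<^sup>2 + (1 + 1/d) * (cmod (a - b))\<^sup>2 - (cmod b + cmod (a - b))\<^sup>2"
      using assms by (simp add: power2_eq_square field_simps)
    finally show ?thesis by simp
  qed
  finally show ?thesis .
qed

lemma energy_le_weighted:
  assumes [measurable]: "f \<in> borel_measurable M" "g \<in> borel_measurable M" and "d > 0"
  shows "energy M f \<le> ennreal (1 + d) * energy M g + ennreal (1 + 1/d) * energy M (\<lambda>x. f x - g x)"
proof -
  have "energy M f \<le> (\<integral>\<^sup>+x. ennreal (1 + d) * ennreal ((cmod (g x))\<^sup>2)
      + ennreal (1 + 1/d) * ennreal ((cmod (f x - g x))\<^sup>2) \<partial>M)"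
    unfolding energy_def using norm_square_le_weighted[OF \<open>d > 0\<close>] \<open>d > 0\<close>
    by (intro nn_integral_mono) (simp add: ennreal_mult[symmetric] ennreal_plus[symmetric] del: ennreal_plus)
  also have "\<dots> = ennreal (1 + d) * energy M g + ennreal (1 + 1/d) * energy M (\<lambda>x. f x - g x)"
    unfolding energy_def by (subst nn_integral_add) (auto simp: nn_integral_cmult)
  finally show ?thesis .
qed

lemma energy_triangle:
  assumes [measurable]: "f \<in> borel_measurable M" "g \<in> borel_measurable M" "h \<in> borel_measurable M"
  shows "energy M (\<lambda>x. f x - h x) \<le> 2 * energy M (\<lambda>x. f x - g x) + 2 * energy M (\<lambda>x. g x - h x)"
  using energy_le_weighted[of "\<lambda>x. f x - h x" M "\<lambda>x. f x - g x" 1] by simp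

lemma energy_add_le:
  assumes [measurable]: "f \<in> borel_measurable M" "g \<in> borel_measurable M"
  shows "energy M (\<lambda>x. f x + g x) \<le> 2 * energy M f + 2 * energy M g"
  using energy_le_weighted[of "\<lambda>x. f x + g x" M "f" 1] by simp

lemma energy_finite_iff:
  assumes [measurable]: "f \<in> borel_measurable M"
  shows "energy M f < \<infinity> \<longleftrightarrow> integrable M (\<lambda>x. (cmod (f x))\<^sup>2)"
  unfolding energy_def integrable_iff_bounded by simp

lemma energy_eq_integral:
  assumes "integrable M (\<lambda>x. (cmod (f x))\<^sup>2)"
  shows "energy M f = ennreal (LINT x|M. (cmod (f x))\<^sup>2)"
  unfolding energy_def using assms by (intro nn_integral_eq_integral) auto

section \<open>Density of trigonometric sums in the square integrable functions\<close>

abbreviation period :: "real measure" where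
  "period \<equiv> lebesgue_on {0..<1}"

lemma finite_measure_period: "finite_measure period"
  by (rule finite_measure_lebesgue_on) (auto intro: bounded_set_imp_lmeasurable)

lemma emeasure_period: "emeasure period {0..<1} = 1"
  by (simp add: emeasure_restrict_space)

lemma borel_measurable_lebesgueI:
  "f \<in> borel_measurable borel \<Longrightarrow> f \<in> borel_measurable lebesgue"
  by (rule measurable_completion) simp

lemma borel_measurable_periodI:
  "f \<in> borel_measurable borel \<Longrightarrow> f \<in> borel_measurable period"
  by (intro measurable_restrict_space1 borel_measurable_lebesgueI)

lemma borel_measurable_trig_sum: "trig_sum A c \<in> borel_measurable borel"
  by (intro borel_measurable_continuous_onI continuous_on_trig_sum)

lemma energy_truncation_tendsto_0:
  assumes [measurable]: "f \<in> borel_measurable M" and "energy M f < \<infinity>"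
  shows "(\<lambda>n. energy M (\<lambda>x. f x - (if cmod (f x) \<le> real n then f x else 0))) \<longlonglongrightarrow> 0"
proof -
  have "(\<lambda>n. \<integral>\<^sup>+x. ennreal ((cmod (f x - (if cmod (f x) \<le> real n then f x else 0)))\<^sup>2) \<partial>M)
      \<longlonglongrightarrow> (\<integral>\<^sup>+x. 0 \<partial>M)"
  proof (rule nn_integral_dominated_convergence[where w = "\<lambda>x. ennreal ((cmod (f x))\<^sup>2)"])
    show "AE x in M. (\<lambda>n. ennreal ((cmod (f x - (if cmod (f x) \<le> real n then f x else 0)))\<^sup>2)) \<longlonglongrightarrow> 0"
    proof (intro AE_I2 tendsto_eventually)
      fix x
      show "\<forall>\<^sub>F n in sequentially. ennreal ((cmod (f x - (if cmod (f x) \<le> real n then f x else 0)))\<^sup>2) = 0"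
        using eventually_ge_at_top[of "nat \<lceil>cmod (f x)\<rceil>"] by eventually_elim (auto simp: nat_le_iff ceiling_le_iff)
    qed
  qed (use assms(2) in \<open>auto simp: energy_def\<close>)
  then show ?thesis by (simp add: energy_def)
qed

text \<open>A measurable function is an almost everywhere limit of continuous ones. Clamping these to the
disc of radius \<open>B\<close> keeps them dominated, and a trapezoid factor makes them vanish at both
endpoints, as is needed to regard them as continuous functions on the circle.\<close>

lemma bounded_continuous_approx_period:
  fixes f :: "real \<Rightarrow> complex"
  assumes [measurable]: "f \<in> borel_measurable lebesgue" and B: "\<And>x. cmod (f x) \<le> B" "B > 0"
  obtains h where "\<And>n. continuous_on UNIV (h n)" "\<And>n. h n 0 = 0" "\<And>n. h n 1 = 0"
    "(\<lambda>n::nat. energy period (\<lambda>x. f x - h n x)) \<longlonglongrightarrow> 0"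
proof -
  have "f measurable_on UNIV"
    by (rule lebesgue_measurable_imp_measurable_on) auto
  then obtain N g where N: "negligible N" and g: "\<And>n. continuous_on UNIV (g n)"
     and lim: "\<And>x. x \<notin> N \<Longrightarrow> (\<lambda>n. g n x) \<longlonglongrightarrow> f x"
    unfolding measurable_on_def by auto
  define T where "T w = (B / max B (cmod w)) *\<^sub>R w" for w :: complex
  define u where "u n x = max 0 (min 1 (real n * min x (1 - x)))" for n :: nat and x :: real
  define h where "h n x = u n x *\<^sub>R T (g n x)" for n x
  have T_bound: "cmod (T w) \<le> B" for w
    using \<open>B > 0\<close> by (auto simp: T_def field_simps max_def)
  have T_cont: "continuous_on UNIV T"
    unfolding T_def using \<open>B > 0\<close> by (intro continuous_intros) (auto simp: max_def)
  have u01: "0 \<le> u n x" "u n x \<le> 1" for n x by (auto simp: u_def)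
  have h_bound: "cmod (h n x) \<le> B" for n x
    using mult_mono[OF u01(2) T_bound] u01(1)[of n x] by (simp add: h_def)
  have h_cont: "continuous_on UNIV (h n)" for n
  proof -
    have "continuous_on UNIV (\<lambda>x. T (g n x))"
      using continuous_on_compose2[OF T_cont g] by auto
    then show ?thesis unfolding h_def u_def by (intro continuous_intros)
  qed
  have [measurable]: "h n \<in> borel_measurable period" for n
    by (intro borel_measurable_periodI borel_measurable_continuous_onI h_cont)
  have [measurable]: "f \<in> borel_measurable period"
    by (intro measurable_restrict_space1) fact
  have lim_h: "(\<lambda>n. h n x) \<longlonglongrightarrow> f x" if "x \<in> {0<..<1}" "x \<notin> N" for x
  proof -
    have "(\<lambda>n. T (g n x)) \<longlonglongrightarrow> T (f x)"
      by (rule continuous_on_tendsto_compose[OF T_cont lim[OF that(2)]]) auto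
    moreover have "T (f x) = f x"
      using B(1)[of x] B(2) by (cases "cmod (f x) = B") (auto simp: T_def max_def)
    moreover have "(\<lambda>n. u n x) \<longlonglongrightarrow> 1"
    proof (rule tendsto_eventually)
      have pos: "min x (1 - x) > 0" using that(1) by auto
      show "\<forall>\<^sub>F n in sequentially. u n x = 1"
        using eventually_ge_at_top[of "nat \<lceil>1 / min x (1 - x)\<rceil>"]
      proof eventually_elim
        case (elim n)
        then have "1 / min x (1 - x) \<le> real n" by linarith
        then have "1 \<le> real n * min x (1 - x)" using pos by (simp add: divide_le_eq)
        then show ?case by (simp add: u_def)
      qed
    qed
    ultimately have "(\<lambda>n. u n x *\<^sub>R T (g n x)) \<longlonglongrightarrow> 1 *\<^sub>R f x"
      by (intro tendsto_scaleR) auto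
    then show ?thesis by (simp add: h_def)
  qed
  have "(\<lambda>n. \<integral>\<^sup>+x. ennreal ((cmod (f x - h n x))\<^sup>2) \<partial>period) \<longlonglongrightarrow> (\<integral>\<^sup>+x. 0 \<partial>period)"
  proof (rule nn_integral_dominated_convergence[where w = "\<lambda>x. ennreal ((2 * B)\<^sup>2)"])
    show "AE x in period. ennreal ((cmod (f x - h j x))\<^sup>2) \<le> ennreal ((2 * B)\<^sup>2)" for j
    proof (intro AE_I2 ennreal_leI power_mono)
      fix x show "cmod (f x - h j x) \<le> 2 * B"
        using norm_triangle_ineq4[of "f x" "h j x"] B(1)[of x] h_bound[of j x] by linarith
    qed auto
    show "(\<integral>\<^sup>+x. ennreal ((2 * B)\<^sup>2) \<partial>period) < \<infinity>"
      by (simp add: emeasure_period)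
    have "AE x in lebesgue. x \<in> {0..<1} \<longrightarrow> x \<noteq> 0 \<and> x \<notin> N"
    proof -
      have "N \<union> {0} \<in> null_sets lebesgue"
        using N by (simp add: negligible_iff_null_sets[symmetric])
      from AE_not_in[OF this] show ?thesis by eventually_elim auto
    qed
    then have "AE x in period. x \<noteq> 0 \<and> x \<notin> N"
      by (subst AE_restrict_space_iff) auto
    then have "AE x in period. (\<lambda>n. h n x) \<longlonglongrightarrow> f x"
      using AE_space by eventually_elim (auto intro!: lim_h)
    then show "AE x in period. (\<lambda>n. ennreal ((cmod (f x - h n x))\<^sup>2)) \<longlonglongrightarrow> 0"
    proof eventually_elim
      case (elim x)
      have "(\<lambda>n. ennreal ((cmod (f x - h n x))\<^sup>2)) \<longlonglongrightarrow> ennreal ((cmod (f x - f x))\<^sup>2)"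
        by (intro tendsto_intros elim)
      then show ?case by simp
    qed
  qed auto
  then have "(\<lambda>n. energy period (\<lambda>x. f x - h n x)) \<longlonglongrightarrow> 0" by (simp add: energy_def)
  moreover have "h n 0 = 0" "h n 1 = 0" for n by (auto simp: h_def u_def)
  ultimately show ?thesis using that h_cont by blast
qed

text \<open>Truncate, approximate the bounded function by a continuous one that vanishes at \<open>0\<close> and \<open>1\<close>, and
approximate that one uniformly by a trigonometric sum.\<close>

lemma trig_sums_dense_period:
  assumes [measurable]: "f \<in> borel_measurable lebesgue" and "energy period f < \<infinity>" and "e > (0::real)"
  obtains A c where "finite A" "energy period (\<lambda>x. f x - trig_sum A c x) < ennreal e"
proof -
  have fm [measurable]: "f \<in> borel_measurable period"
    by (intro measurable_restrict_space1) fact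
  have "eventually (\<lambda>n. energy period (\<lambda>x. f x - (if cmod (f x) \<le> real n then f x else 0)) < ennreal (e/20)) sequentially"
    using assms by (intro order_tendstoD(2)[OF energy_truncation_tendsto_0]) auto
  then obtain n where n: "energy period (\<lambda>x. f x - (if cmod (f x) \<le> real n then f x else 0)) < ennreal (e/20)"
    by (meson eventually_sequentially order_refl)
  define f1 where "f1 x = (if cmod (f x) \<le> real n then f x else 0)" for x
  have f1 [measurable]: "f1 \<in> borel_measurable lebesgue" unfolding f1_def by measurable
  have f1' [measurable]: "f1 \<in> borel_measurable period"
    by (intro measurable_restrict_space1) fact
  obtain h where h: "\<And>n. continuous_on UNIV (h n)" "\<And>n. h n 0 = 0" "\<And>n. h n 1 = 0"
    "(\<lambda>n::nat. energy period (\<lambda>x. f1 x - h n x)) \<longlonglongrightarrow> 0"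
    by (rule bounded_continuous_approx_period[OF f1, of "real n + 1"]) (auto simp: f1_def)
  have "eventually (\<lambda>n. energy period (\<lambda>x. f1 x - h n x) < ennreal (e/20)) sequentially"
    using assms by (intro order_tendstoD(2)[OF h(4)]) auto
  then obtain m where m: "energy period (\<lambda>x. f1 x - h m x) < ennreal (e/20)"
    by (meson eventually_sequentially order_refl)
  have [measurable]: "h m \<in> borel_measurable period"
    by (intro borel_measurable_periodI borel_measurable_continuous_onI h)
  have e20: "sqrt (e/20) > 0" using assms by simp
  obtain A c where A: "finite A" and unif: "\<And>t. t \<in> {0..1} \<Longrightarrow> cmod (h m t - trig_sum A c t) < sqrt (e/20)"
    by (rule trig_polys_uniformly_dense[OF continuous_on_subset[OF h(1)[of m]] _ e20]) (auto simp: h)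
  have [measurable]: "trig_sum A c \<in> borel_measurable period"
    by (intro borel_measurable_periodI borel_measurable_trig_sum)
  have "energy period (\<lambda>x. h m x - trig_sum A c x) \<le> (\<integral>\<^sup>+x. ennreal (e/20) \<partial>period)"
    unfolding energy_def
  proof (rule nn_integral_mono)
    fix x assume "x \<in> space period"
    then have "cmod (h m x - trig_sum A c x) \<le> sqrt (e/20)" using unif[of x] by auto
    then have "(cmod (h m x - trig_sum A c x))\<^sup>2 \<le> (sqrt (e/20))\<^sup>2" by (intro power_mono) auto
    then show "ennreal ((cmod (h m x - trig_sum A c x))\<^sup>2) \<le> ennreal (e/20)"
      using assms by (intro ennreal_leI) simp
  qed
  then have t: "energy period (\<lambda>x. h m x - trig_sum A c x) \<le> ennreal (e/20)"
    by (simp add: emeasure_period)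
  have "energy period (\<lambda>x. f x - trig_sum A c x)
     \<le> 2 * energy period (\<lambda>x. f x - f1 x) + 2 * energy period (\<lambda>x. f1 x - trig_sum A c x)"
    by (rule energy_triangle) auto
  also have "\<dots> \<le> 2 * energy period (\<lambda>x. f x - f1 x) + 2 * (2 * energy period (\<lambda>x. f1 x - h m x)
     + 2 * energy period (\<lambda>x. h m x - trig_sum A c x))"
    by (intro add_left_mono mult_left_mono energy_triangle) auto
  also have "\<dots> \<le> 2 * ennreal (e/20) + 2 * (2 * ennreal (e/20) + 2 * ennreal (e/20))"
    using n m t unfolding f1_def[symmetric] by (intro add_mono mult_left_mono) auto
  also have "\<dots> = ennreal (e/2)"
  proof -
    \<comment> \<open>The three errors are multiplied by 2, 4 and 4; hence 1/20 of \<open>e\<close> for each of them suffices.\<close>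
    have "2 * ennreal a + 2 * (2 * ennreal a + 2 * ennreal a) = ennreal (10 * a)" if "a \<ge> 0" for a
    proof -
      have "2 * ennreal a + 2 * (2 * ennreal a + 2 * ennreal a) = ennreal 10 * ennreal a"
        by (simp add: algebra_simps) (simp only: distrib_left[symmetric], simp)
      then show ?thesis using that by (simp add: ennreal_mult)
    qed
    from this[of "e/20"] show ?thesis using assms by simp
  qed
  also have "\<dots> < ennreal e" using assms by (intro ennreal_lessI) auto
  finally show ?thesis using A that by blast
qed

section \<open>Parseval's identity on the unit interval\<close>

lemma borel_measurable_cnj [measurable]:
  "f \<in> borel_measurable M \<Longrightarrow> (\<lambda>x. cnj (f x)) \<in> borel_measurable M"
  by (rule borel_measurable_continuous_on[where f = cnj]) (intro continuous_intros)

lemma integrable_periodI: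
  assumes "continuous_on UNIV f"
  shows "integrable period (f :: real \<Rightarrow> complex)"
proof -
  have "integrable (lebesgue_on {0..1}) f"
    by (intro continuous_imp_integrable_real continuous_on_subset[OF assms]) auto
  then have "set_integrable lebesgue {0..1} f"
    by (simp add: integrable_restrict_space set_integrable_def)
  then have "set_integrable lebesgue {0..<1} f"
    by (rule set_integrable_subset) auto
  then show ?thesis
    by (simp add: integrable_restrict_space set_integrable_def)
qed

lemma integral_harmonic_period:
  "(LINT x|period. harmonic (of_int n * x)) = (if n = 0 then 1 else 0)"
proof (cases "n = 0")
  case True
  then show ?thesis by (simp add: measure_restrict_space)
next
  case False
  define F where "F x = harmonic (of_int n * x) / (2 * pi * \<i> * of_int n)" for x
  have "((\<lambda>x. harmonic (of_int n * x)) has_integral F 1 - F 0) {0..1}"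
  proof (rule fundamental_theorem_of_calculus)
    fix x :: real
    have "((\<lambda>z. exp (2 * pi * \<i> * of_int n * z) / (2 * pi * \<i> * of_int n))
        has_field_derivative exp (2 * pi * \<i> * of_int n * of_real x)) (at (of_real x))"
      using False by (auto intro!: derivative_eq_intros)
    from has_vector_derivative_real_field[OF has_field_derivative_at_within[OF this]]
    show "(F has_vector_derivative harmonic (of_int n * x)) (at x within {0..1})"
      by (simp add: F_def[abs_def] harmonic_def cis_conv_exp mult_ac)
  qed simp
  moreover have "F 1 = F 0" using harmonic_of_int[of n] by (simp add: F_def)
  ultimately have "((\<lambda>x. harmonic (of_int n * x)) has_integral 0) {0..1}" by simp
  then have "((\<lambda>x. harmonic (of_int n * x)) has_integral 0) {0..<1}"
    by (subst has_integral_spike_set_eq[where T = "{0..1}"]) (auto intro: negligible_subset[of "{1}"])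
  moreover have "integrable period (\<lambda>x. harmonic (of_int n * x))"
    by (intro integrable_periodI continuous_intros)
  ultimately show ?thesis
    using False by (simp add: lebesgue_integral_eq_integral integral_unique)
qed

definition fourier_coeff :: "(real \<Rightarrow> complex) \<Rightarrow> int \<Rightarrow> complex" where
  "fourier_coeff f k = (LINT x|period. f x * harmonic (- (of_int k * x)))"

lemma norm_le_1_plus_square: "cmod z \<le> 1 + (cmod z)\<^sup>2"
  using zero_le_power2[of "cmod z - 1/2"] by (simp add: power2_eq_square algebra_simps)

lemma integrable_period_of_square:
  fixes f :: "real \<Rightarrow> complex"
  assumes [measurable]: "f \<in> borel_measurable period" and "integrable period (\<lambda>x. (cmod (f x))\<^sup>2)"
  shows "integrable period f"
proof -
  interpret finite_measure period by (rule finite_measure_period)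
  have "integrable period (\<lambda>x. 1 + (cmod (f x))\<^sup>2)"
    using assms by auto
  then show ?thesis
  proof (rule Bochner_Integration.integrable_bound)
    show "AE x in period. norm (f x) \<le> norm (1 + (cmod (f x))\<^sup>2)"
      using norm_le_1_plus_square by auto
  qed auto
qed

lemma integrable_mult_bounded:
  fixes f g :: "'a \<Rightarrow> complex"
  assumes "integrable M f" "g \<in> borel_measurable M" "\<And>x. cmod (g x) \<le> B"
  shows "integrable M (\<lambda>x. f x * g x)"
proof (rule Bochner_Integration.integrable_bound)
  show "integrable M (\<lambda>x. B * cmod (f x))" using assms(1) by auto
  have "0 \<le> B" using assms(3)[of undefined] norm_ge_zero order_trans by blast
  then show "AE x in M. norm (f x * g x) \<le> norm (B * cmod (f x))"
    using assms(3) by (auto simp: norm_mult mult.commute[of B] intro!: mult_left_mono)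
qed (use assms in auto)

lemma norm_trig_sum_le: "cmod (trig_sum A c x) \<le> (\<Sum>k\<in>A. cmod (c k))"
  unfolding trig_sum_def by (rule order_trans[OF norm_sum]) (simp add: norm_mult)

lemma integral_norm_trig_sum_square:
  assumes "finite A"
  shows "(LINT x|period. (cmod (trig_sum A c x))\<^sup>2) = (\<Sum>k\<in>A. (cmod (c k))\<^sup>2)"
proof -
  have *: "complex_of_real ((cmod (trig_sum A c x))\<^sup>2)
      = (\<Sum>k\<in>A. \<Sum>l\<in>A. c k * cnj (c l) * harmonic (of_int (k - l) * x))" for x
    unfolding complex_norm_square
    by (simp add: trig_sum_def sum_product left_diff_distrib right_diff_distrib mult_ac flip: harmonic_add)
  have "complex_of_real (LINT x|period. (cmod (trig_sum A c x))\<^sup>2)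
      = (LINT x|period. (\<Sum>k\<in>A. \<Sum>l\<in>A. c k * cnj (c l) * harmonic (of_int (k - l) * x)))"
    unfolding integral_complex_of_real[symmetric] * ..
  also have "\<dots> = (\<Sum>k\<in>A. \<Sum>l\<in>A. c k * cnj (c l) * (if k = l then 1 else 0))"
    by (subst Bochner_Integration.integral_sum
        | intro Bochner_Integration.integrable_sum integrable_mult_right integrable_periodI continuous_intros
        | rule sum.cong refl
        | simp add: integral_harmonic_period del: of_int_diff)+
  also have "\<dots> = complex_of_real (\<Sum>k\<in>A. (cmod (c k))\<^sup>2)"
    using assms by (simp add: if_distrib sum.delta' complex_norm_square[symmetric] cong: if_cong)
  finally show ?thesis by (simp only: of_real_eq_iff)
qed

text \<open>The expansion that completes the square in the coefficients. With \<open>d\<close> equal to the Fourier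
coefficients it yields Bessel's inequality, and in general it shows that this choice of \<open>d\<close> is
the best one.\<close>

lemma integral_minus_trig_sum_square:
  assumes [measurable]: "f \<in> borel_measurable period" and sq: "integrable period (\<lambda>x. (cmod (f x))\<^sup>2)"
    and "finite A"
  shows "integrable period (\<lambda>x. (cmod (f x - trig_sum A d x))\<^sup>2)"
    and "(LINT x|period. (cmod (f x - trig_sum A d x))\<^sup>2) =
     (LINT x|period. (cmod (f x))\<^sup>2) - (\<Sum>k\<in>A. (cmod (fourier_coeff f k))\<^sup>2)
     + (\<Sum>k\<in>A. (cmod (d k - fourier_coeff f k))\<^sup>2)"
proof -
  interpret finite_measure period by (rule finite_measure_period)
  have [measurable]: "trig_sum A d \<in> borel_measurable period"
    by (intro borel_measurable_periodI borel_measurable_trig_sum)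
  have int_f: "integrable period f" by (rule integrable_period_of_square) fact+
  have int_T: "integrable period (\<lambda>x. (cmod (trig_sum A d x))\<^sup>2)"
    by (rule integrable_const_bound[where B = "(\<Sum>k\<in>A. cmod (d k))\<^sup>2"])
       (auto intro!: power_mono norm_trig_sum_le AE_I2)
  have int_fT: "integrable period (\<lambda>x. f x * cnj (trig_sum A d x))"
    by (rule integrable_mult_bounded[OF int_f, of _ "\<Sum>k\<in>A. cmod (d k)"]) (auto simp: norm_trig_sum_le)
  define P where "P x = Re (f x * cnj (trig_sum A d x))" for x
  have int_P: "integrable period P" unfolding P_def using int_fT by (rule integrable_Re)
  have expand: "(cmod (f x - trig_sum A d x))\<^sup>2 =
     (cmod (f x))\<^sup>2 - 2 * P x + (cmod (trig_sum A d x))\<^sup>2" for x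
    unfolding P_def by (simp only: cmod_power2) (simp add: power2_eq_square algebra_simps)
  show "integrable period (\<lambda>x. (cmod (f x - trig_sum A d x))\<^sup>2)"
    unfolding expand using sq int_P int_T by auto
  have complete_square: "(cmod (d k))\<^sup>2 - 2 * Re (cnj (d k) * fourier_coeff f k) =
     (cmod (d k - fourier_coeff f k))\<^sup>2 - (cmod (fourier_coeff f k))\<^sup>2" for k
    by (simp only: cmod_power2) (simp add: power2_eq_square algebra_simps)
  have "(LINT x|period. f x * cnj (trig_sum A d x)) =
     (LINT x|period. (\<Sum>k\<in>A. cnj (d k) * (f x * harmonic (- (of_int k * x)))))"
    by (simp add: trig_sum_def sum_distrib_left mult_ac)
  also have "\<dots> = (\<Sum>k\<in>A. cnj (d k) * fourier_coeff f k)"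
  proof -
    have "integrable period (\<lambda>x. f x * harmonic (- (of_int k * x)))" for k
      by (rule integrable_mult_bounded[OF int_f, of _ 1])
         (auto intro!: borel_measurable_periodI)
    then show ?thesis
      by (subst Bochner_Integration.integral_sum) (auto simp: fourier_coeff_def)
  qed
  finally have fT: "(LINT x|period. P x) = Re (\<Sum>k\<in>A. cnj (d k) * fourier_coeff f k)"
    unfolding P_def using int_fT by (metis integral_Re)
  have "(LINT x|period. (cmod (f x - trig_sum A d x))\<^sup>2) =
      (LINT x|period. (cmod (f x))\<^sup>2) - 2 * Re (\<Sum>k\<in>A. cnj (d k) * fourier_coeff f k) + (\<Sum>k\<in>A. (cmod (d k))\<^sup>2)"
    unfolding expand using sq int_P int_T fT integral_norm_trig_sum_square[OF \<open>finite A\<close>]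
    by simp
  also have "\<dots> = (LINT x|period. (cmod (f x))\<^sup>2)
     + (\<Sum>k\<in>A. (cmod (d k))\<^sup>2 - 2 * Re (cnj (d k) * fourier_coeff f k))"
    by (simp add: sum_subtractf sum_distrib_left)
  also have "\<dots> = (LINT x|period. (cmod (f x))\<^sup>2)
     + (\<Sum>k\<in>A. (cmod (d k - fourier_coeff f k))\<^sup>2 - (cmod (fourier_coeff f k))\<^sup>2)"
    unfolding complete_square ..
  finally show "(LINT x|period. (cmod (f x - trig_sum A d x))\<^sup>2) =
     (LINT x|period. (cmod (f x))\<^sup>2) - (\<Sum>k\<in>A. (cmod (fourier_coeff f k))\<^sup>2)
     + (\<Sum>k\<in>A. (cmod (d k - fourier_coeff f k))\<^sup>2)"
    by (simp add: sum_subtractf)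
qed

lemma nn_integral_count_space_int_eq_SUP:
  "(\<integral>\<^sup>+k. f k \<partial>count_space UNIV) = (SUP n::nat. \<Sum>k\<in>{- int n..int n}. f k)"
proof -
  have f: "f k = (SUP n::nat. f k * indicator {- int n..int n} k)" for k
  proof (rule antisym)
    have "f k = f k * indicator {- int (nat \<bar>k\<bar>)..int (nat \<bar>k\<bar>)} k" by (auto simp: indicator_def)
    also have "\<dots> \<le> (SUP n::nat. f k * indicator {- int n..int n} k)" by (rule SUP_upper) auto
    finally show "f k \<le> (SUP n::nat. f k * indicator {- int n..int n} k)" .
  qed (auto intro!: SUP_least simp: indicator_def)
  have "(\<integral>\<^sup>+k. f k \<partial>count_space UNIV) = (SUP n::nat. \<integral>\<^sup>+k. f k * indicator {- int n..int n} k \<partial>count_space UNIV)"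
    by (subst f, rule nn_integral_monotone_convergence_SUP)
       (auto simp: incseq_def le_fun_def indicator_def)
  also have "\<dots> = (SUP n::nat. \<Sum>k\<in>{- int n..int n}. f k)"
  proof (intro arg_cong[where f = Sup] image_cong refl)
    fix n :: nat
    show "(\<integral>\<^sup>+k. f k * indicator {- int n..int n} k \<partial>count_space UNIV) = (\<Sum>k\<in>{- int n..int n}. f k)"
      by (subst nn_integral_count_space'[of "{- int n..int n}"]) auto
  qed
  finally show ?thesis .
qed

text \<open>Bessel's inequality bounds the partial sums from above; the density of trigonometric sums and
the optimality of the Fourier coefficients bound them from below up to any \<open>e\<close>.\<close>

theorem parseval_period:
  assumes fm: "f \<in> borel_measurable lebesgue" and "energy period f < \<infinity>"
  shows "(\<integral>\<^sup>+k. ennreal ((cmod (fourier_coeff f k))\<^sup>2) \<partial>count_space UNIV) = energy period f"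
proof -
  have [measurable]: "f \<in> borel_measurable period"
    by (intro measurable_restrict_space1) fact
  have sq: "integrable period (\<lambda>x. (cmod (f x))\<^sup>2)"
    using assms(2) by (rule energy_finite_iff[THEN iffD1, rotated]) fact
  let ?I = "LINT x|period. (cmod (f x))\<^sup>2" and ?c = "\<lambda>k. (cmod (fourier_coeff f k))\<^sup>2"
  note * = integral_minus_trig_sum_square[OF \<open>f \<in> borel_measurable period\<close> sq]
  have bessel: "(\<Sum>k\<in>A. ?c k) \<le> ?I" if "finite A" for A
  proof -
    have "0 \<le> (LINT x|period. (cmod (f x - trig_sum A (fourier_coeff f) x))\<^sup>2)" by simp
    then show ?thesis by (simp add: *(2)[OF that])
  qed
  have "(SUP n::nat. \<Sum>k\<in>{- int n..int n}. ennreal (?c k)) = ennreal ?I"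
  proof (rule antisym)
    show "(SUP n::nat. \<Sum>k\<in>{- int n..int n}. ennreal (?c k)) \<le> ennreal ?I"
      by (intro SUP_least) (auto intro!: ennreal_leI bessel)
    show "ennreal ?I \<le> (SUP n::nat. \<Sum>k\<in>{- int n..int n}. ennreal (?c k))"
    proof (rule ennreal_le_epsilon)
      fix e :: real assume "e > 0"
      obtain A d where A: "finite A" and close: "energy period (\<lambda>x. f x - trig_sum A d x) < ennreal e"
        using trig_sums_dense_period[OF assms \<open>e > 0\<close>] by blast
      have "?I - (\<Sum>k\<in>A. ?c k) \<le> (LINT x|period. (cmod (f x - trig_sum A d x))\<^sup>2)"
        unfolding *(2)[OF A] by (simp add: sum_nonneg)
      also have "\<dots> < e"
        using close \<open>e > 0\<close> by (simp add: energy_eq_integral[OF *(1)[OF A]] ennreal_less_iff)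
      finally have "?I \<le> (\<Sum>k\<in>A. ?c k) + e" by simp
      obtain n :: nat where n: "A \<subseteq> {- int n..int n}"
      proof -
        have "k \<in> {- int (nat (\<Sum>k\<in>A. \<bar>k\<bar>))..int (nat (\<Sum>k\<in>A. \<bar>k\<bar>))}" if "k \<in> A" for k
          using member_le_sum[OF that, of abs] A by (auto simp: sum_nonneg)
        then show ?thesis using that by blast
      qed
      have "?I \<le> (\<Sum>k\<in>{- int n..int n}. ?c k) + e"
        using \<open>?I \<le> _\<close> sum_mono2[OF _ n, of ?c] by fastforce
      then have "ennreal ?I \<le> ennreal (\<Sum>k\<in>{- int n..int n}. ?c k) + ennreal e"
        using \<open>e > 0\<close> by (subst ennreal_plus[symmetric]) (auto intro!: ennreal_leI sum_nonneg)
      also have "ennreal (\<Sum>k\<in>{- int n..int n}. ?c k) = (\<Sum>k\<in>{- int n..int n}. ennreal (?c k))"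
        by simp
      also have "\<dots> \<le> (SUP n::nat. \<Sum>k\<in>{- int n..int n}. ennreal (?c k))"
        by (rule SUP_upper) auto
      finally show "ennreal ?I \<le> (SUP n::nat. \<Sum>k\<in>{- int n..int n}. ennreal (?c k)) + ennreal e"
        by simp
    qed
  qed
  then show ?thesis
    by (simp add: nn_integral_count_space_int_eq_SUP energy_eq_integral[OF sq])
qed

section \<open>Plancherel's theorem for compactly supported functions\<close>

lemma measurable_lebesgue_affine:
  fixes c t :: real
  assumes "c \<noteq> 0"
  shows "(\<lambda>x. t + c * x) \<in> lebesgue \<rightarrow>\<^sub>M lebesgue"
  using lebesgue_affine_measurable[where c = "\<lambda>x::real. c"] assms by simp

lemma borel_measurable_lebesgue_affine:
  fixes c t :: real
  assumes "f \<in> borel_measurable lebesgue" "c \<noteq> 0"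
  shows "(\<lambda>x. f (t + c * x)) \<in> borel_measurable lebesgue"
  using measurable_compose[OF measurable_lebesgue_affine assms(1)] assms(2) .

lemma energy_affine:
  assumes "f \<in> borel_measurable lebesgue" "c \<noteq> (0::real)"
  shows "energy lebesgue f = ennreal \<bar>c\<bar> * energy lebesgue (\<lambda>x. f (t + c * x))"
  unfolding energy_def using assms by (intro nn_integral_real_affine_lebesgue) auto

lemma energy_period: "energy period f = energy lebesgue (\<lambda>x. indicator {0..<1} x * f x)"
  unfolding energy_def
  by (subst nn_integral_restrict_space) (auto intro!: nn_integral_cong simp: indicator_def)

text \<open>Every real number is in exactly one translate of \<open>[0, 1)\<close> by an integer; the sum over the
translates may be exchanged with the integral.\<close>

lemma nn_integral_periodize:
  fixes f :: "real \<Rightarrow> ennreal"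
  assumes [measurable]: "f \<in> borel_measurable lebesgue"
  shows "(\<integral>\<^sup>+x. f x \<partial>lebesgue) = (\<integral>\<^sup>+x. (\<integral>\<^sup>+k. f (x + of_int k) \<partial>count_space UNIV) \<partial>period)"
proof -
  define J where "J = (indicator {0..<1} :: real \<Rightarrow> ennreal)"
  have [measurable]: "J \<in> borel_measurable lebesgue"
    unfolding J_def by (intro borel_measurable_lebesgueI) measurable
  have trans [measurable]: "(\<lambda>x. g (x + real_of_int k)) \<in> borel_measurable lebesgue"
    "(\<lambda>x. g (x - real_of_int k)) \<in> borel_measurable lebesgue"
    if "g \<in> borel_measurable lebesgue" for k and g :: "real \<Rightarrow> ennreal"
    using borel_measurable_lebesgue_affine[OF that, of 1 "of_int k"]
          borel_measurable_lebesgue_affine[OF that, of 1 "- of_int k"] by (simp_all add: add.commute)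
  have one: "(\<integral>\<^sup>+k. J (x - of_int k) \<partial>count_space UNIV) = 1" for x
  proof -
    have "J (x - of_int k) = indicator {\<lfloor>x\<rfloor>} k" for k
      by (auto simp: J_def indicator_def floor_eq_iff) (linarith | simp add: floor_unique)+
    then show ?thesis by simp
  qed
  have "(\<integral>\<^sup>+x. f x \<partial>lebesgue) = (\<integral>\<^sup>+x. (\<integral>\<^sup>+k. f x * J (x - of_int k) \<partial>count_space UNIV) \<partial>lebesgue)"
    by (simp add: nn_integral_cmult one)
  also have "\<dots> = (\<integral>\<^sup>+k. (\<integral>\<^sup>+x. f x * J (x - of_int k) \<partial>lebesgue) \<partial>count_space UNIV)"
    by (rule nn_integral_count_space_nn_integral) auto
  also have "\<dots> = (\<integral>\<^sup>+k. (\<integral>\<^sup>+x. J x * f (x + of_int k) \<partial>lebesgue) \<partial>count_space UNIV)"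
  proof (rule nn_integral_cong)
    fix k :: int
    have "(\<lambda>x. f x * J (x - of_int k)) \<in> borel_measurable lebesgue" by measurable
    from nn_integral_real_affine_lebesgue[OF this, of 1 "of_int k"]
    show "(\<integral>\<^sup>+x. f x * J (x - of_int k) \<partial>lebesgue) = (\<integral>\<^sup>+x. J x * f (x + of_int k) \<partial>lebesgue)"
      by (simp add: ac_simps)
  qed
  also have "\<dots> = (\<integral>\<^sup>+x. (\<integral>\<^sup>+k. J x * f (x + of_int k) \<partial>count_space UNIV) \<partial>lebesgue)"
    by (rule nn_integral_count_space_nn_integral[symmetric]) auto
  also have "\<dots> = (\<integral>\<^sup>+x. (\<integral>\<^sup>+k. f (x + of_int k) \<partial>count_space UNIV) * indicator {0..<1} x \<partial>lebesgue)"
    by (simp add: nn_integral_cmult J_def mult.commute)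
  also have "\<dots> = (\<integral>\<^sup>+x. (\<integral>\<^sup>+k. f (x + of_int k) \<partial>count_space UNIV) \<partial>period)"
    by (subst nn_integral_restrict_space) auto
  finally show ?thesis .
qed

definition fourier_integral :: "(real \<Rightarrow> complex) \<Rightarrow> real \<Rightarrow> complex" where
  "fourier_integral f \<xi> = (LINT x|lebesgue. f x * harmonic (- (x * \<xi>)))"

lemma borel_measurable_harmonic_lebesgue [measurable]:
  "(\<lambda>x. harmonic (c * x)) \<in> borel_measurable lebesgue"
  "(\<lambda>x. harmonic (x * c)) \<in> borel_measurable lebesgue"
  "(\<lambda>x. harmonic (- (c * x))) \<in> borel_measurable lebesgue"
  "(\<lambda>x. harmonic (- (x * c))) \<in> borel_measurable lebesgue"
  by (auto intro!: borel_measurable_lebesgueI)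

lemma integrable_mult_harmonic:
  assumes "integrable lebesgue f"
  shows "integrable lebesgue (\<lambda>x. f x * harmonic (- (x * \<xi>)))"
  by (rule integrable_mult_bounded[OF assms, of _ 1]) auto

lemma continuous_fourier_integral:
  assumes "integrable lebesgue f"
  shows "continuous_on UNIV (fourier_integral f)"
proof (rule continuous_on_sequentiallyI)
  fix u :: "nat \<Rightarrow> real" and a :: real
  assume "u \<longlonglongrightarrow> a"
  show "(\<lambda>n. fourier_integral f (u n)) \<longlonglongrightarrow> fourier_integral f a"
    unfolding fourier_integral_def
  proof (rule integral_dominated_convergence[where w = "\<lambda>x. cmod (f x)"])
    have "isCont harmonic t" for t
      using continuous_harmonic by (simp add: continuous_on_eq_continuous_at)
    then have "(\<lambda>n. f x * harmonic (- (x * u n))) \<longlonglongrightarrow> f x * harmonic (- (x * a))" for x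
      by (intro tendsto_intros isCont_tendsto_compose[of _ harmonic] \<open>u \<longlonglongrightarrow> a\<close>)
    then show "AE x in lebesgue. (\<lambda>n. f x * harmonic (- (x * u n))) \<longlonglongrightarrow> f x * harmonic (- (x * a))"
      by simp
  qed (use assms in \<open>auto simp: norm_mult\<close>)
qed

lemma borel_measurable_fourier_integral:
  "integrable lebesgue f \<Longrightarrow> fourier_integral f \<in> borel_measurable lebesgue"
  by (intro borel_measurable_lebesgueI borel_measurable_continuous_onI continuous_fourier_integral)

lemma integrable_compact_support:
  fixes f :: "real \<Rightarrow> complex"
  assumes [measurable]: "f \<in> borel_measurable lebesgue" and fin: "energy lebesgue f < \<infinity>"
    and supp: "\<And>x. \<bar>x\<bar> > R \<Longrightarrow> f x = 0"
  shows "integrable lebesgue f"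
proof (rule Bochner_Integration.integrable_bound)
  have "integrable lebesgue (\<lambda>x. (cmod (f x))\<^sup>2)"
    using fin by (rule energy_finite_iff[THEN iffD1, rotated]) fact
  moreover have "integrable lebesgue (indicator {-R..R} :: real \<Rightarrow> real)"
    by (rule integrable_real_indicator) (auto simp: emeasure_lborel_Icc_eq)
  ultimately show "integrable lebesgue (\<lambda>x. indicator {-R..R} x + (cmod (f x))\<^sup>2)"
    by auto
  have "norm (f x) \<le> norm (indicator {-R..R} x + (cmod (f x))\<^sup>2)" for x
  proof (cases "\<bar>x\<bar> > R")
    case True
    then show ?thesis using supp by simp
  next
    case False
    then have "indicator {-R..R} x = (1::real)" by (auto simp: indicator_def)
    then show ?thesis using norm_le_1_plus_square[of "f x"] by simp
  qed
  then show "AE x in lebesgue. norm (f x) \<le> norm (indicator {-R..R} x + (cmod (f x))\<^sup>2)"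
    by simp
qed fact

text \<open>The values of the Fourier integral at \<open>\<theta> + k\<close> are the Fourier coefficients of
\<open>f(x) exp(-2\<pi>i\<theta>x)\<close>, which has the same norm for all \<open>\<theta>\<close>. Parseval's identity and integration
over \<open>\<theta>\<close> in a period finish the proof.\<close>

lemma plancherel_unit_interval:
  assumes fm [measurable]: "f \<in> borel_measurable lebesgue" and fin: "energy lebesgue f < \<infinity>"
    and supp: "\<And>x. x \<notin> {0..<1} \<Longrightarrow> f x = 0"
  shows "energy lebesgue (fourier_integral f) = energy lebesgue f"
proof -
  have int: "integrable lebesgue f"
    by (rule integrable_compact_support[OF fm fin, of 1]) (rule supp, auto)
  note [measurable] = borel_measurable_fourier_integral[OF int]
  have ind: "indicator {0..<1} x *\<^sub>R (f x * w) = f x * w" for x w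
    using supp[of x] by (auto simp: indicator_def)
  have coeff: "fourier_integral f (\<theta> + of_int k) = fourier_coeff (\<lambda>x. f x * harmonic (- (\<theta> * x))) k" for \<theta> k
    unfolding fourier_integral_def fourier_coeff_def
    by (subst integral_restrict_space)
       (auto intro!: Bochner_Integration.integral_cong
         simp: ind ring_distribs mult_ac simp flip: harmonic_add)
  have inner: "(\<integral>\<^sup>+k. ennreal ((cmod (fourier_integral f (\<theta> + of_int k)))\<^sup>2) \<partial>count_space UNIV) = energy lebesgue f" for \<theta>
  proof -
    have "energy period (\<lambda>x. f x * harmonic (- (\<theta> * x))) = energy lebesgue f"
      unfolding energy_period by (rule energy_cong_AE) (auto simp: norm_mult indicator_def supp)
    then show ?thesis unfolding coeff using fin
      by (subst parseval_period) auto
  qed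
  have "energy lebesgue (fourier_integral f) = (\<integral>\<^sup>+\<theta>. energy lebesgue f \<partial>period)"
    unfolding energy_def[of _ "fourier_integral f"]
    by (subst nn_integral_periodize) (auto simp: inner)
  then show ?thesis by (simp add: emeasure_period)
qed

text \<open>An affine substitution moves the support into the unit interval.\<close>

theorem plancherel_compact_support:
  assumes fm [measurable]: "f \<in> borel_measurable lebesgue" and fin: "energy lebesgue f < \<infinity>"
    and supp: "\<And>x. \<bar>x\<bar> > R \<Longrightarrow> f x = 0"
  shows "energy lebesgue (fourier_integral f) = energy lebesgue f"
proof -
  \<comment> \<open>The map \<open>y \<mapsto> t + c * y\<close> takes \<open>[0, 1)\<close> to \<open>[-c/2, c/2)\<close>, which contains \<open>[-R, R]\<close>.\<close>
  define c where "c = 4 * max R 1"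
  define t where "t = - (c / 2)"
  have "c > 0" by (simp add: c_def)
  define g where "g y = f (t + c * y)" for y
  have int: "integrable lebesgue f"
    by (rule integrable_compact_support[OF fm fin supp])
  have gm [measurable]: "g \<in> borel_measurable lebesgue"
    unfolding g_def using \<open>c > 0\<close> by (intro borel_measurable_lebesgue_affine) auto
  have fg: "energy lebesgue f = ennreal c * energy lebesgue g"
    using energy_affine[OF fm, of c t] \<open>c > 0\<close> by (simp add: g_def[abs_def])
  then have "energy lebesgue g < \<infinity>"
    using fin \<open>c > 0\<close> by (auto simp: ennreal_mult_less_top)
  moreover have gsupp: "g y = 0" if "y \<notin> {0..<1}" for y
  proof -
    have "c / 2 \<le> \<bar>c * y - c / 2\<bar>"
    proof (cases "y < 0")
      case True
      then have "c * y \<le> 0" using \<open>c > 0\<close> by (simp add: mult_le_0_iff)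
      then show ?thesis by linarith
    next
      case False
      then have "c * 1 \<le> c * y" using that \<open>c > 0\<close> by (intro mult_left_mono) auto
      then show ?thesis by linarith
    qed
    then have "\<bar>t + c * y\<bar> > R" unfolding t_def c_def by linarith
    then show ?thesis by (simp add: g_def supp)
  qed
  ultimately have plancherel_g: "energy lebesgue (fourier_integral g) = energy lebesgue g"
    by (intro plancherel_unit_interval gm)
  have "integrable lebesgue g"
    using int \<open>c > 0\<close> unfolding g_def by (subst lebesgue_integrable_real_affine_iff) auto
  note [measurable] = borel_measurable_fourier_integral[OF this]
  have "fourier_integral f \<xi> = c * harmonic (- (t * \<xi>)) * fourier_integral g (0 + c * \<xi>)" for \<xi>
  proof -
    have "fourier_integral f \<xi> = c *\<^sub>R (LINT y|lebesgue. g y * harmonic (- ((t + c * y) * \<xi>)))"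
      unfolding fourier_integral_def using \<open>c > 0\<close>
      by (subst lebesgue_integral_real_affine[of c _ t]) (auto simp: g_def)
    also have "(LINT y|lebesgue. g y * harmonic (- ((t + c * y) * \<xi>)))
        = (LINT y|lebesgue. harmonic (- (t * \<xi>)) * (g y * harmonic (- (y * (c * \<xi>)))))"
      by (rule Bochner_Integration.integral_cong) (auto simp: algebra_simps simp flip: harmonic_add)
    finally show ?thesis
      by (simp add: fourier_integral_def scaleR_conv_of_real)
  qed
  then have "energy lebesgue (fourier_integral f)
      = energy lebesgue (\<lambda>\<xi>. of_real c * fourier_integral g (0 + c * \<xi>))"
    by (intro energy_cong_AE) (auto simp: norm_mult)
  also have "\<dots> = ennreal (c\<^sup>2) * energy lebesgue (\<lambda>\<xi>. fourier_integral g (0 + c * \<xi>))"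
    using \<open>c > 0\<close> by (subst energy_scale) (auto intro!: borel_measurable_lebesgue_affine simp del: add_0)
  also have "\<dots> = ennreal c * (ennreal c * energy lebesgue (\<lambda>\<xi>. fourier_integral g (0 + c * \<xi>)))"
    using \<open>c > 0\<close> by (simp add: power2_eq_square ennreal_mult mult_ac)
  also have "\<dots> = ennreal c * energy lebesgue (fourier_integral g)"
    using \<open>c > 0\<close> by (subst energy_affine[of "fourier_integral g" c 0]) auto
  finally show ?thesis
    by (simp add: plancherel_g fg)
qed

section \<open>The Fourier transform on square integrable functions\<close>

lemma L2_iff: "f \<in> L2 \<longleftrightarrow> f \<in> borel_measurable lebesgue \<and> energy lebesgue f < \<infinity>"
  unfolding L2_def using energy_finite_iff[of f lebesgue] by auto

definition restrict_to :: "real \<Rightarrow> (real \<Rightarrow> complex) \<Rightarrow> real \<Rightarrow> complex" where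
  "restrict_to R f x = (if \<bar>x\<bar> \<le> R then f x else 0)"

lemma restrict_to_eq_indicator: "restrict_to R f = (\<lambda>x. indicator {-R..R} x * f x)"
  by (auto simp: restrict_to_def fun_eq_iff split: split_indicator)

lemma truncated_fourier_eq: "truncated_fourier f R = fourier_integral (restrict_to R f)"
  unfolding truncated_fourier_def fourier_integral_def set_lebesgue_integral_def restrict_to_def harmonic_def
  by (intro ext Bochner_Integration.integral_cong)
     (auto simp: indicator_def mult_ac)

lemma restrict_to_L2:
  assumes "f \<in> L2"
  shows "restrict_to R f \<in> borel_measurable lebesgue" "energy lebesgue (restrict_to R f) \<le> energy lebesgue f"
    "energy lebesgue (restrict_to R f) < \<infinity>" "integrable lebesgue (restrict_to R f)"
proof -
  have [measurable]: "f \<in> borel_measurable lebesgue" using assms by (simp add: L2_iff)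
  show m: "restrict_to R f \<in> borel_measurable lebesgue"
    unfolding restrict_to_eq_indicator by (intro borel_measurable_times borel_measurable_indicator) auto
  show le: "energy lebesgue (restrict_to R f) \<le> energy lebesgue f"
    unfolding energy_def restrict_to_def by (intro nn_integral_mono) (auto simp: indicator_def)
  then show fin: "energy lebesgue (restrict_to R f) < \<infinity>"
    using assms by (auto simp: L2_iff intro: le_less_trans)
  show "integrable lebesgue (restrict_to R f)"
    by (rule integrable_compact_support[OF m fin, of R]) (auto simp: restrict_to_def)
qed

lemma borel_measurable_truncated_fourier:
  "f \<in> L2 \<Longrightarrow> truncated_fourier f R \<in> borel_measurable lebesgue"
  unfolding truncated_fourier_eq by (intro borel_measurable_fourier_integral restrict_to_L2)

lemma energy_truncated_fourier:
  assumes "f \<in> L2"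
  shows "energy lebesgue (truncated_fourier f R) = energy lebesgue (restrict_to R f)"
  unfolding truncated_fourier_eq
  by (rule plancherel_compact_support[OF restrict_to_L2(1,3)[OF assms], of R]) (auto simp: restrict_to_def)

lemma energy_restrict_to_tendsto:
  assumes "f \<in> L2"
  shows "((\<lambda>R. energy lebesgue (restrict_to R f)) \<longlongrightarrow> energy lebesgue f) at_top"
proof -
  have [measurable]: "f \<in> borel_measurable lebesgue" "\<And>R. restrict_to R f \<in> borel_measurable lebesgue"
    using assms restrict_to_L2(1) by (auto simp: L2_iff)
  have sq: "integrable lebesgue (\<lambda>x. (cmod (f x))\<^sup>2)"
    using assms by (simp add: L2_def)
  have sq': "integrable lebesgue (\<lambda>x. (cmod (restrict_to R f x))\<^sup>2)" for R
    using restrict_to_L2(3)[OF assms, of R] energy_finite_iff[of "restrict_to R f" lebesgue] by simp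
  have "((\<lambda>R. LINT x|lebesgue. (cmod (restrict_to R f x))\<^sup>2) \<longlongrightarrow> (LINT x|lebesgue. (cmod (f x))\<^sup>2)) at_top"
  proof (rule integral_dominated_convergence_at_top[OF _ _ sq])
    have "((\<lambda>R. (cmod (restrict_to R f x))\<^sup>2) \<longlongrightarrow> (cmod (f x))\<^sup>2) at_top" for x
      by (rule tendsto_eventually, use eventually_ge_at_top[of "\<bar>x\<bar>"] in eventually_elim)
         (auto simp: restrict_to_def)
    then show "AE x in lebesgue. ((\<lambda>R. (cmod (restrict_to R f x))\<^sup>2) \<longlongrightarrow> (cmod (f x))\<^sup>2) at_top" by simp
    show "\<forall>\<^sub>F R in at_top. AE x in lebesgue. norm ((cmod (restrict_to R f x))\<^sup>2) \<le> (cmod (f x))\<^sup>2"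
      by (intro always_eventually allI AE_I2) (auto simp: restrict_to_def indicator_def)
  qed auto
  then show ?thesis
    by (simp add: energy_eq_integral sq sq' tendsto_ennrealI)
qed

lemma ennreal_le_if_le_weighted:
  assumes "\<And>d. d > 0 \<Longrightarrow> a \<le> ennreal (1 + d) * b"
  shows "a \<le> b"
proof (cases b)
  case (real r)
  show ?thesis
  proof (rule ennreal_le_epsilon)
    fix e :: real assume "e > 0"
    have "a \<le> ennreal (1 + e / (r + 1)) * b"
      using \<open>e > 0\<close> real by (intro assms) auto
    also have "\<dots> = ennreal ((1 + e / (r + 1)) * r)"
      using \<open>e > 0\<close> real by (simp add: ennreal_mult)
    also have "\<dots> \<le> ennreal (r + e)"
      using \<open>e > 0\<close> real by (intro ennreal_leI) (auto simp: field_simps)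
    finally show "a \<le> b + ennreal e" using real \<open>e > 0\<close> by simp
  qed
qed simp

lemma has_fourier_transform_L2:
  assumes "has_fourier_transform f g"
  shows "f \<in> L2" "g \<in> L2"
  using assms by (auto simp: has_fourier_transform_def)

text \<open>The truncations have the right norms by the case of compact support; their norms converge to the
norm of \<open>f\<close> on one side and, by convergence in \<open>L\<^sup>2\<close>, to the norm of \<open>g\<close> on the other side.\<close>

theorem plancherel:
  assumes "has_fourier_transform f g"
  shows "energy lebesgue f = energy lebesgue g"
proof -
  note L2 = has_fourier_transform_L2[OF assms]
  let ?T = "truncated_fourier f"
  have [measurable]: "g \<in> borel_measurable lebesgue" "\<And>R. ?T R \<in> borel_measurable lebesgue"
    using L2 borel_measurable_truncated_fourier by (auto simp: L2_iff)
  have D: "((\<lambda>R. energy lebesgue (\<lambda>\<xi>. ?T R \<xi> - g \<xi>)) \<longlongrightarrow> 0) at_top"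
    using assms by (simp add: has_fourier_transform_def L2_dist_sq_eq_energy)
  have T: "((\<lambda>R. energy lebesgue (?T R)) \<longlongrightarrow> energy lebesgue f) at_top"
    using energy_restrict_to_tendsto[OF L2(1)] by (simp add: energy_truncated_fourier[OF L2(1)])
  show ?thesis
  proof (rule antisym; rule ennreal_le_if_le_weighted)
    fix d :: real assume d: "d > 0"
    have "((\<lambda>R. ennreal (1 + d) * energy lebesgue g + ennreal (1 + 1/d) * energy lebesgue (\<lambda>\<xi>. ?T R \<xi> - g \<xi>))
        \<longlongrightarrow> ennreal (1 + d) * energy lebesgue g + ennreal (1 + 1/d) * 0) at_top"
      by (intro tendsto_intros ennreal_tendsto_cmult D) auto
    from tendsto_le[OF _ this T] energy_le_weighted[of "?T _" lebesgue g d] d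
    show "energy lebesgue f \<le> ennreal (1 + d) * energy lebesgue g"
      by simp
    have "((\<lambda>R. ennreal (1 + d) * energy lebesgue (?T R) + ennreal (1 + 1/d) * energy lebesgue (\<lambda>\<xi>. ?T R \<xi> - g \<xi>))
        \<longlongrightarrow> ennreal (1 + d) * energy lebesgue f + ennreal (1 + 1/d) * 0) at_top"
      by (intro tendsto_intros ennreal_tendsto_cmult D T) auto
    moreover have "energy lebesgue g \<le> ennreal (1 + d) * energy lebesgue (?T R)
        + ennreal (1 + 1/d) * energy lebesgue (\<lambda>\<xi>. ?T R \<xi> - g \<xi>)" for R
      using energy_le_weighted[of g lebesgue "?T R" d] d
        energy_cong_AE[of "\<lambda>\<xi>. g \<xi> - ?T R \<xi>" "\<lambda>\<xi>. ?T R \<xi> - g \<xi>" lebesgue]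
      by (simp add: norm_minus_commute)
    ultimately have "energy lebesgue g \<le> ennreal (1 + d) * energy lebesgue f + ennreal (1 + 1/d) * 0"
      by (intro tendsto_lowerbound[where F = at_top]) auto
    then show "energy lebesgue g \<le> ennreal (1 + d) * energy lebesgue f"
      by simp
  qed
qed

lemma L2_add: "f \<in> L2 \<Longrightarrow> g \<in> L2 \<Longrightarrow> (\<lambda>x. f x + g x) \<in> L2"
  using energy_add_le[of f lebesgue g]
  by (auto simp: L2_iff ennreal_mult_less_top intro: le_less_trans)

lemma L2_scale: "f \<in> L2 \<Longrightarrow> (\<lambda>x. c * f x) \<in> L2"
  by (auto simp: L2_iff energy_scale ennreal_mult_less_top)

text \<open>Truncated transforms are additive, and the squared distance of two sums is at most twice the sum
of the squared distances.\<close>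

lemma has_fourier_transform_add:
  assumes "has_fourier_transform f1 g1" "has_fourier_transform f2 g2"
  shows "has_fourier_transform (\<lambda>x. f1 x + f2 x) (\<lambda>\<xi>. g1 \<xi> + g2 \<xi>)"
proof -
  note L2 = has_fourier_transform_L2[OF assms(1)] has_fourier_transform_L2[OF assms(2)]
  have [measurable]: "g1 \<in> borel_measurable lebesgue" "g2 \<in> borel_measurable lebesgue"
    "\<And>R. truncated_fourier f1 R \<in> borel_measurable lebesgue" "\<And>R. truncated_fourier f2 R \<in> borel_measurable lebesgue"
    using L2 borel_measurable_truncated_fourier by (auto simp: L2_iff)
  have "truncated_fourier (\<lambda>x. f1 x + f2 x) R \<xi> = truncated_fourier f1 R \<xi> + truncated_fourier f2 R \<xi>" for R \<xi>
  proof -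
    have "restrict_to R (\<lambda>x. f1 x + f2 x) = (\<lambda>x. restrict_to R f1 x + restrict_to R f2 x)"
      by (auto simp: restrict_to_def distrib_left)
    then show ?thesis
      unfolding truncated_fourier_eq fourier_integral_def
      by (simp add: distrib_right Bochner_Integration.integral_add integrable_mult_harmonic restrict_to_L2 L2)
  qed
  then have bound: "L2_dist_sq (truncated_fourier (\<lambda>x. f1 x + f2 x) R) (\<lambda>\<xi>. g1 \<xi> + g2 \<xi>)
     \<le> 2 * L2_dist_sq (truncated_fourier f1 R) g1 + 2 * L2_dist_sq (truncated_fourier f2 R) g2" for R
    using energy_add_le[of "\<lambda>\<xi>. truncated_fourier f1 R \<xi> - g1 \<xi>" lebesgue "\<lambda>\<xi>. truncated_fourier f2 R \<xi> - g2 \<xi>"]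
    by (simp add: L2_dist_sq_eq_energy algebra_simps)
  have "((\<lambda>R. 2 * L2_dist_sq (truncated_fourier f1 R) g1 + 2 * L2_dist_sq (truncated_fourier f2 R) g2)
      \<longlongrightarrow> 2 * 0 + 2 * 0) at_top"
    using assms by (intro tendsto_intros ennreal_tendsto_cmult) (auto simp: has_fourier_transform_def)
  then have lim: "((\<lambda>R. 2 * L2_dist_sq (truncated_fourier f1 R) g1 + 2 * L2_dist_sq (truncated_fourier f2 R) g2)
      \<longlongrightarrow> 0) at_top"
    by simp
  have "((\<lambda>R. L2_dist_sq (truncated_fourier (\<lambda>x. f1 x + f2 x) R) (\<lambda>\<xi>. g1 \<xi> + g2 \<xi>)) \<longlongrightarrow> 0) at_top"
    by (rule tendsto_sandwich[OF _ _ tendsto_const lim]) (simp_all add: bound)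
  then show ?thesis
    using L2 by (auto simp: has_fourier_transform_def intro: L2_add)
qed

lemma has_fourier_transform_scale:
  assumes "has_fourier_transform f g"
  shows "has_fourier_transform (\<lambda>x. c * f x) (\<lambda>\<xi>. c * g \<xi>)"
proof -
  note L2 = has_fourier_transform_L2[OF assms]
  have [measurable]: "g \<in> borel_measurable lebesgue" "\<And>R. truncated_fourier f R \<in> borel_measurable lebesgue"
    using L2 borel_measurable_truncated_fourier by (auto simp: L2_iff)
  have "truncated_fourier (\<lambda>x. c * f x) R \<xi> = c * truncated_fourier f R \<xi>" for R \<xi>
  proof -
    have "(\<lambda>x. restrict_to R (\<lambda>x. c * f x) x * harmonic (- (x * \<xi>))) = (\<lambda>x. c * (restrict_to R f x * harmonic (- (x * \<xi>))))"
      by (auto simp: restrict_to_def)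
    then show ?thesis
      unfolding truncated_fourier_eq fourier_integral_def by simp
  qed
  then have "L2_dist_sq (truncated_fourier (\<lambda>x. c * f x) R) (\<lambda>\<xi>. c * g \<xi>)
     = ennreal ((cmod c)\<^sup>2) * L2_dist_sq (truncated_fourier f R) g" for R
    by (simp add: L2_dist_sq_eq_energy energy_scale flip: right_diff_distrib)
  moreover have "((\<lambda>R. ennreal ((cmod c)\<^sup>2) * L2_dist_sq (truncated_fourier f R) g) \<longlongrightarrow> ennreal ((cmod c)\<^sup>2) * 0) at_top"
    using assms by (intro ennreal_tendsto_cmult) (auto simp: has_fourier_transform_def)
  ultimately show ?thesis
    using L2 by (auto simp: has_fourier_transform_def intro: L2_scale)
qed

lemma has_fourier_transform_0: "has_fourier_transform (\<lambda>x. 0) (\<lambda>\<xi>. 0)"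
  by (simp add: has_fourier_transform_def L2_def truncated_fourier_def L2_dist_sq_def)

lemma has_fourier_transform_sum:
  assumes "finite I" "\<And>i. i \<in> I \<Longrightarrow> has_fourier_transform (f i) (g i)"
  shows "has_fourier_transform (\<lambda>x. \<Sum>i\<in>I. c i * f i x) (\<lambda>\<xi>. \<Sum>i\<in>I. c i * g i \<xi>)"
  using assms
proof (induction I rule: finite_induct)
  case (insert j I)
  then have "has_fourier_transform (\<lambda>x. c j * f j x + (\<Sum>i\<in>I. c i * f i x)) (\<lambda>\<xi>. c j * g j \<xi> + (\<Sum>i\<in>I. c i * g i \<xi>))"
    by (intro has_fourier_transform_add has_fourier_transform_scale) auto
  with insert show ?case by simp
qed (simp add: has_fourier_transform_0)

lemma L2_dist_sq_fourier_transform: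
  assumes "has_fourier_transform f g" "has_fourier_transform f' g'"
  shows "L2_dist_sq f f' = L2_dist_sq g g'"
  using plancherel[OF has_fourier_transform_add[OF assms(1) has_fourier_transform_scale[OF assms(2), of "-1"]]]
  by (simp add: L2_dist_sq_eq_energy)

lemma integrable_mult_cnj:
  assumes "f \<in> L2" "g \<in> L2"
  shows "integrable lebesgue (\<lambda>x. f x * cnj (g x))"
proof (rule Bochner_Integration.integrable_bound)
  show "integrable lebesgue (\<lambda>x. (cmod (f x))\<^sup>2 + (cmod (g x))\<^sup>2)"
    using assms by (auto simp: L2_def)
  have [measurable]: "f \<in> borel_measurable lebesgue" "g \<in> borel_measurable lebesgue"
    using assms by (auto simp: L2_iff)
  show "(\<lambda>x. f x * cnj (g x)) \<in> borel_measurable lebesgue" by measurable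
  have "a * b \<le> a\<^sup>2 + b\<^sup>2" if "a \<ge> 0" "b \<ge> 0" for a b :: real
    using zero_le_power2[of "a - b"] mult_nonneg_nonneg[OF that] by (simp add: power2_diff)
  then show "AE x in lebesgue. norm (f x * cnj (g x)) \<le> norm ((cmod (f x))\<^sup>2 + (cmod (g x))\<^sup>2)"
    by (simp add: norm_mult)
qed

text \<open>The polarization formula: letting \<open>c\<close> be \<open>1\<close> and \<open>\<i>\<close> it recovers the inner product from norms.\<close>

lemma integral_norm_add_square:
  assumes "f \<in> L2" "g \<in> L2"
  shows "(LINT x|lebesgue. (cmod (f x + c * g x))\<^sup>2) = (LINT x|lebesgue. (cmod (f x))\<^sup>2)
     + (cmod c)\<^sup>2 * (LINT x|lebesgue. (cmod (g x))\<^sup>2) + 2 * Re (cnj c * L2_inner f g)"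
proof -
  define P where "P x = Re (cnj c * (f x * cnj (g x)))" for x
  have int: "integrable lebesgue (\<lambda>x. cnj c * (f x * cnj (g x)))"
    using integrable_mult_cnj[OF assms] by auto
  then have int_P: "integrable lebesgue P" unfolding P_def by (rule integrable_Re)
  have "(LINT x|lebesgue. P x) = Re (cnj c * L2_inner f g)"
    unfolding P_def L2_inner_def integral_mult_right_zero[symmetric] using int by (rule integral_Re)
  moreover have "(cmod (f x + c * g x))\<^sup>2 = (cmod (f x))\<^sup>2 + (cmod c)\<^sup>2 * (cmod (g x))\<^sup>2 + 2 * P x" for x
    unfolding P_def by (simp only: cmod_power2) (simp add: power2_eq_square algebra_simps)
  ultimately show ?thesis
    using int_P assms by (simp add: L2_def)
qed

theorem L2_inner_fourier_transform:
  assumes "has_fourier_transform f g" "has_fourier_transform f' g'"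
  shows "L2_inner f f' = L2_inner g g'"
proof -
  note L2 = has_fourier_transform_L2[OF assms(1)] has_fourier_transform_L2[OF assms(2)]
  have isometry: "(LINT x|lebesgue. (cmod (u x))\<^sup>2) = (LINT x|lebesgue. (cmod (v x))\<^sup>2)"
    if "has_fourier_transform u v" for u v
  proof -
    have "integrable lebesgue (\<lambda>x. (cmod (u x))\<^sup>2)" "integrable lebesgue (\<lambda>x. (cmod (v x))\<^sup>2)"
      using has_fourier_transform_L2[OF that] by (auto simp: L2_def)
    then show ?thesis
      using plancherel[OF that] by (simp add: energy_eq_integral)
  qed
  have "Re (cnj c * L2_inner f f') = Re (cnj c * L2_inner g g')" for c
    using integral_norm_add_square[OF L2(1,3), of c] integral_norm_add_square[OF L2(2,4), of c]
      isometry[OF assms(1)] isometry[OF assms(2)]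
      isometry[OF has_fourier_transform_add[OF assms(1) has_fourier_transform_scale[OF assms(2), of c]]]
    by simp
  from this[of 1] this[of \<i>] show ?thesis
    by (simp add: complex_eq_iff)
qed

section \<open>Inverse transforms of compactly supported functions\<close>

lemma sigma_finite_lebesgue: "sigma_finite_measure (lebesgue :: real measure)"
proof (rule sigma_finite_measure.intro)
  from lborel.sigma_finite_countable obtain A :: "real set set" where A: "countable A" "A \<subseteq> sets lborel" "\<Union>A = space lborel"
      "\<forall>a\<in>A. emeasure lborel a \<noteq> \<infinity>"
    by (elim exE conjE)
  have "emeasure lebesgue a \<noteq> \<infinity>" if "a \<in> A" for a
  proof -
    have a: "a \<in> sets lborel" by (rule subsetD[OF A(2) that])
    show ?thesis
      using bspec[OF A(4) that]
      unfolding emeasure_completion[OF sets_completionI_sets[OF a]] main_part[OF a] .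
  qed
  moreover have "A \<subseteq> sets lebesgue"
    by (rule subsetI, rule sets_completionI_sets) (rule subsetD[OF A(2)])
  moreover have "\<Union>A = space lebesgue" by (simp add: A(3))
  ultimately have "countable A \<and> A \<subseteq> sets lebesgue \<and> \<Union>A = space lebesgue \<and>
      (\<forall>a\<in>A. emeasure lebesgue a \<noteq> \<infinity>)"
    using A(1) by simp
  then show "\<exists>A :: real set set. countable A \<and> A \<subseteq> sets lebesgue \<and> \<Union>A = space lebesgue \<and>
      (\<forall>a\<in>A. emeasure lebesgue a \<noteq> \<infinity>)"
    by (rule exI)
qed

text \<open>The multiplication formula, an instance of Fubini's theorem.\<close>

lemma fourier_integral_swap:
  assumes f: "integrable lebesgue f" and g: "integrable lebesgue g"
  shows "(LINT \<xi>|lebesgue. fourier_integral f \<xi> * cnj (g \<xi>))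
     = (LINT x|lebesgue. f x * cnj (fourier_integral g (- x)))"
proof -
  interpret sigma_finite_measure "lebesgue :: real measure" by (rule sigma_finite_lebesgue)
  interpret pair_sigma_finite "lebesgue :: real measure" "lebesgue :: real measure" ..
  define F where "F x \<xi> = f x * cnj (g \<xi>) * harmonic (- (x * \<xi>))" for x \<xi>
  have [measurable]: "f \<in> borel_measurable lebesgue" "g \<in> borel_measurable lebesgue"
    using f g by auto
  have id [measurable]: "(\<lambda>x. x) \<in> borel_measurable (lebesgue :: real measure)"
    by (rule borel_measurable_lebesgueI) simp
  have "case_prod F \<in> borel_measurable (lebesgue \<Otimes>\<^sub>M lebesgue)"
  proof -
    have [measurable]: "fst \<in> borel_measurable (lebesgue \<Otimes>\<^sub>M (lebesgue :: real measure) :: (real \<times> real) measure)"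
      "snd \<in> borel_measurable ((lebesgue :: real measure) \<Otimes>\<^sub>M lebesgue :: (real \<times> real) measure)"
      using measurable_compose[OF measurable_fst id] measurable_compose[OF measurable_snd id] by auto
    show ?thesis unfolding F_def[abs_def] split_beta' by measurable
  qed
  moreover have "integrable lebesgue (\<lambda>x. LINT \<xi>|lebesgue. norm (F x \<xi>))"
    using f by (simp add: F_def norm_mult)
  moreover have "integrable lebesgue (F x)" for x
  proof -
    have "integrable lebesgue (\<lambda>\<xi>. cnj (g \<xi>) * harmonic (- (\<xi> * x)))"
      using g by (intro integrable_mult_harmonic) auto
    then show ?thesis unfolding F_def by (simp add: mult_ac)
  qed
  ultimately have "integrable (lebesgue \<Otimes>\<^sub>M lebesgue) (case_prod F)"
    by (intro Fubini_integrable) auto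
  from Fubini_integral[OF this]
  have "(LINT \<xi>|lebesgue. LINT x|lebesgue. F x \<xi>) = (LINT x|lebesgue. LINT \<xi>|lebesgue. F x \<xi>)" .
  moreover have "(LINT x|lebesgue. F x \<xi>) = fourier_integral f \<xi> * cnj (g \<xi>)" for \<xi>
  proof -
    have "F x \<xi> = cnj (g \<xi>) * (f x * harmonic (- (x * \<xi>)))" for x
      by (simp add: F_def)
    then show ?thesis by (simp add: fourier_integral_def)
  qed
  moreover have "(LINT \<xi>|lebesgue. F x \<xi>) = f x * cnj (fourier_integral g (- x))" for x
  proof -
    have "F x \<xi> = f x * cnj (g \<xi> * harmonic (- (\<xi> * (- x))))" for \<xi>
      by (simp add: F_def mult_ac)
    then show ?thesis by (simp only: fourier_integral_def integral_mult_right_zero Bochner_Integration.integral_cnj)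
  qed
  ultimately show ?thesis by simp
qed

text \<open>Let \<open>T R\<close> be the transform of the inverse Fourier integral \<open>\<psi>\<close> of \<open>g\<close>, truncated to \<open>[-R, R]\<close>. Its
squared norm and, by the multiplication formula, its inner product with \<open>g\<close> both equal the
integral of \<open>\<bar>\<psi>\<bar>\<^sup>2\<close> over \<open>[-R, R]\<close>. Therefore the squared distance of \<open>T R\<close> and \<open>g\<close> is the squared
norm of \<open>g\<close> minus this integral. The difference tends to \<open>0\<close>, because \<open>g\<close> and \<open>\<psi>\<close> have the same
norm.\<close>

theorem fourier_inversion_compact_support:
  assumes gL2: "g \<in> L2" and supp: "\<And>\<xi>. \<bar>\<xi>\<bar> > N \<Longrightarrow> g \<xi> = 0"
  shows "has_fourier_transform (\<lambda>x. fourier_integral g (- x)) g"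
proof -
  define \<psi> where "\<psi> x = fourier_integral g (- x)" for x
  have gm [measurable]: "g \<in> borel_measurable lebesgue" and gfin: "energy lebesgue g < \<infinity>"
    using gL2 by (auto simp: L2_iff)
  have gint: "integrable lebesgue g"
    by (rule integrable_compact_support[OF gm gfin supp])
  have \<psi>m [measurable]: "\<psi> \<in> borel_measurable lebesgue"
    unfolding \<psi>_def using borel_measurable_lebesgue_affine[OF borel_measurable_fourier_integral[OF gint], of "-1" 0]
    by simp
  have e\<psi>: "energy lebesgue \<psi> = energy lebesgue g"
    using energy_affine[OF borel_measurable_fourier_integral[OF gint], of "-1" 0]
      plancherel_compact_support[OF gm gfin supp]
    by (simp add: \<psi>_def[abs_def])
  have \<psi>L2: "\<psi> \<in> L2" using e\<psi> gfin by (simp add: L2_iff)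
  let ?T = "truncated_fourier \<psi>"
  have [measurable]: "\<And>R. ?T R \<in> borel_measurable lebesgue"
    by (rule borel_measurable_truncated_fourier[OF \<psi>L2])
  have TL2: "?T R \<in> L2" for R
    using restrict_to_L2(3)[OF \<psi>L2, of R] by (simp add: L2_iff energy_truncated_fourier[OF \<psi>L2])
  define sq where "sq u = (LINT x|lebesgue. (cmod (u x))\<^sup>2)" for u :: "real \<Rightarrow> complex"
  have sq: "energy lebesgue u = ennreal (sq u)" if "u \<in> L2" for u
    using that unfolding sq_def by (intro energy_eq_integral) (simp add: L2_def)
  have sq_nonneg: "sq u \<ge> 0" for u by (simp add: sq_def)
  have restrict_toL2: "restrict_to R \<psi> \<in> L2" for R using restrict_to_L2[OF \<psi>L2] by (simp add: L2_iff)
  have sqT: "sq (?T R) = sq (restrict_to R \<psi>)" for R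
    using energy_truncated_fourier[OF \<psi>L2, of R] sq[OF TL2] sq[OF restrict_toL2] sq_nonneg by simp
  have sq\<psi>: "sq \<psi> = sq g"
    using e\<psi> sq[OF \<psi>L2] sq[OF gL2] sq_nonneg by simp
  have inner: "L2_inner (?T R) g = of_real (sq (restrict_to R \<psi>))" for R
  proof -
    have "L2_inner (?T R) g = (LINT x|lebesgue. restrict_to R \<psi> x * cnj (\<psi> x))"
      unfolding L2_inner_def truncated_fourier_eq \<psi>_def[symmetric]
      by (subst fourier_integral_swap[OF restrict_to_L2(4)[OF \<psi>L2] gint]) (simp add: \<psi>_def)
    also have "\<dots> = (LINT x|lebesgue. of_real ((cmod (restrict_to R \<psi> x))\<^sup>2))"
      by (intro Bochner_Integration.integral_cong)
         (auto simp: restrict_to_def indicator_def complex_norm_square simp del: of_real_power)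
    finally show ?thesis by (simp only: sq_def integral_complex_of_real)
  qed
  have "L2_dist_sq (?T R) g = ennreal (sq g - sq (restrict_to R \<psi>))" for R
  proof -
    have "(\<lambda>x. ?T R x + (-1) * g x) \<in> L2"
      by (intro L2_add TL2 L2_scale gL2)
    then have "L2_dist_sq (?T R) g = ennreal (sq (\<lambda>x. ?T R x + (-1) * g x))"
      by (subst sq[symmetric]) (auto simp: L2_dist_sq_eq_energy)
    also have "sq (\<lambda>x. ?T R x + (-1) * g x) = sq g - sq (restrict_to R \<psi>)"
      unfolding sq_def integral_norm_add_square[OF TL2 gL2] inner
      using sqT[of R] by (simp add: sq_def)
    finally show ?thesis .
  qed
  moreover have "((\<lambda>R. ennreal (sq g - sq (restrict_to R \<psi>))) \<longlongrightarrow> ennreal (sq g - sq g)) at_top"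
  proof -
    have "((\<lambda>R. ennreal (sq (restrict_to R \<psi>))) \<longlongrightarrow> ennreal (sq g)) at_top"
      using energy_restrict_to_tendsto[OF \<psi>L2] by (simp add: sq restrict_toL2 \<psi>L2 sq\<psi>)
    then have "((\<lambda>R. sq (restrict_to R \<psi>)) \<longlongrightarrow> sq g) at_top"
      by (rule tendsto_ennrealD) (auto simp: sq_nonneg)
    then show ?thesis by (intro tendsto_ennrealI tendsto_intros)
  qed
  ultimately show ?thesis
    using \<psi>L2 gL2 by (simp add: has_fourier_transform_def \<psi>_def[abs_def])
qed

section \<open>Sets that tile under integer translations and under dyadic dilations\<close>

locale translation_dilation_tile =
  fixes K :: "real set"
  assumes K_measurable: "K \<in> sets lebesgue"
    and K_positive: "K \<subseteq> {0<..}"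
    and K_bounded: "bounded K"
    and translation_tile: "\<And>x. \<exists>!k::int. x + of_int k \<in> K"
    and dilation_tile: "\<And>x. x > 0 \<Longrightarrow> \<exists>!j::int. 2 powi j * x \<in> K"
begin

text \<open>The periodic function that agrees with \<open>u\<close> on \<open>K\<close>.\<close>

definition periodized :: "(real \<Rightarrow> complex) \<Rightarrow> real \<Rightarrow> complex" where
  "periodized u x = u (x + of_int (THE k. x + of_int k \<in> K))"

lemma periodized_eq: "x + of_int k \<in> K \<Longrightarrow> periodized u x = u (x + of_int k)"
  unfolding periodized_def using translation_tile[of x] by (metis the_equality)

text \<open>It is the pointwise limit of sums of translates of the restriction of \<open>u\<close> to \<open>K\<close>: at each point
only one of the translates contributes.\<close>

lemma borel_measurable_periodized:
  assumes u: "u \<in> borel_measurable lebesgue"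
  shows "periodized u \<in> borel_measurable lebesgue"
proof (rule borel_measurable_LIMSEQ_metric[where
      f = "\<lambda>n x. \<Sum>k\<in>{- int n..int n}. indicator K (x + of_int k) * u (x + of_int k)"])
  have shift: "(\<lambda>x. v (x + of_int k)) \<in> borel_measurable lebesgue"
    if "v \<in> borel_measurable lebesgue" for v :: "real \<Rightarrow> complex" and k :: int
    using borel_measurable_lebesgue_affine[OF that, of 1 "of_int k"] by (simp add: add.commute)
  have Ku: "(\<lambda>x. indicator K x * u x) \<in> borel_measurable lebesgue"
    by (rule borel_measurable_times[OF borel_measurable_indicator[OF K_measurable] u])
  show "(\<lambda>x. \<Sum>k\<in>{- int n..int n}. indicator K (x + of_int k) * u (x + of_int k)) \<in> borel_measurable lebesgue" for n
    by (rule borel_measurable_sum) (rule shift[OF Ku])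
  fix x
  obtain k where k: "x + of_int k \<in> K" and uniq: "\<And>l. x + of_int l \<in> K \<Longrightarrow> l = k"
    using translation_tile[of x] by blast
  show "(\<lambda>n. \<Sum>k\<in>{- int n..int n}. indicator K (x + of_int k) * u (x + of_int k)) \<longlonglongrightarrow> periodized u x"
  proof (rule tendsto_eventually, use eventually_ge_at_top[of "nat \<bar>k\<bar>"] in eventually_elim)
    case (elim n)
    have "(\<Sum>l\<in>{- int n..int n}. indicator K (x + of_int l) * u (x + of_int l))
       = (\<Sum>l\<in>{- int n..int n}. if l = k then u (x + of_int k) else 0)"
      using k by (intro sum.cong) (auto simp: indicator_def dest: uniq)
    also have "\<dots> = u (x + of_int k)" using elim by (auto simp: sum.delta' nat_le_iff abs_le_iff)
    finally show ?case by (simp add: periodized_eq[OF k])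
  qed
qed

text \<open>This is the use of the translation tiling: \<open>L\<^sup>2(K)\<close> is the same as \<open>L\<^sup>2\<close> of a period.\<close>

lemma energy_periodized:
  assumes u: "u \<in> borel_measurable lebesgue"
  shows "energy lebesgue (\<lambda>x. indicator K x * u x) = energy period (periodized u)"
proof -
  have [measurable]: "(\<lambda>x. indicator K x * u x) \<in> borel_measurable lebesgue"
    by (rule borel_measurable_times[OF borel_measurable_indicator[OF K_measurable] u])
  have "energy lebesgue (\<lambda>x. indicator K x * u x) =
    (\<integral>\<^sup>+x. (\<integral>\<^sup>+k. ennreal ((cmod (indicator K (x + of_int k) * u (x + of_int k)))\<^sup>2) \<partial>count_space UNIV) \<partial>period)"
    unfolding energy_def by (rule nn_integral_periodize) measurable
  also have "\<dots> = energy period (periodized u)"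
    unfolding energy_def
  proof (rule nn_integral_cong)
    fix x :: real
    obtain k where k: "x + of_int k \<in> K" and uniq: "\<And>l. x + of_int l \<in> K \<Longrightarrow> l = k"
      using translation_tile[of x] by blast
    have "(\<integral>\<^sup>+k. ennreal ((cmod (indicator K (x + of_int k) * u (x + of_int k)))\<^sup>2) \<partial>count_space UNIV)
       = (\<integral>\<^sup>+l. ennreal ((cmod (periodized u x))\<^sup>2) * indicator {k} l \<partial>count_space UNIV)"
      using k by (intro nn_integral_cong) (auto simp: indicator_def periodized_eq dest: uniq)
    then show "(\<integral>\<^sup>+k. ennreal ((cmod (indicator K (x + of_int k) * u (x + of_int k)))\<^sup>2) \<partial>count_space UNIV)
       = ennreal ((cmod (periodized u x))\<^sup>2)"
      by simp
  qed
  finally show ?thesis .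
qed

text \<open>The unitary dilation of \<open>L\<^sup>2\<close> by \<open>2\<^sup>j\<close>, on the Fourier side.\<close>

definition dilate :: "int \<Rightarrow> (real \<Rightarrow> complex) \<Rightarrow> real \<Rightarrow> complex" where
  "dilate j u \<xi> = of_real (2 powr (- real_of_int j / 2)) * u (2 powi (- j) * \<xi>)"

lemma powr_half_square: "(2 powr (real_of_int j / 2))\<^sup>2 = 2 powi j"
  by (simp add: power2_eq_square powr_add[symmetric] powr_real_of_int')

lemma energy_dilate:
  assumes u: "u \<in> borel_measurable lebesgue"
  shows "dilate j u \<in> borel_measurable lebesgue" "energy lebesgue (dilate j u) = energy lebesgue u"
proof -
  have m: "(\<lambda>\<xi>. u (2 powi (- j) * \<xi>)) \<in> borel_measurable lebesgue"
    using borel_measurable_lebesgue_affine[OF u, of "2 powi (- j)" 0] by simp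
  then show "dilate j u \<in> borel_measurable lebesgue"
    unfolding dilate_def[abs_def] by measurable
  have "energy lebesgue (dilate j u) = ennreal (2 powi (- j)) * energy lebesgue (\<lambda>\<xi>. u (2 powi (- j) * \<xi>))"
    unfolding dilate_def[abs_def] energy_scale[OF m]
    using powr_half_square[of "- j"] by simp
  also have "\<dots> = energy lebesgue u"
    using energy_affine[OF u, of "2 powi (- j)" 0] by simp
  finally show "energy lebesgue (dilate j u) = energy lebesgue u" .
qed

section \<open>The dyadic system on the Fourier side\<close>

text \<open>The Fourier transforms of the elements of the dyadic system; see \<open>dyadic_system_wavelet\<close>.\<close>

definition wavelet_hat :: "int \<times> int \<Rightarrow> real \<Rightarrow> complex" where
  "wavelet_hat i = dilate (fst i) (\<lambda>\<xi>. indicator K \<xi> * harmonic (- (of_int (snd i) * \<xi>)))"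

lemma sum_wavelet_hat:
  "(\<Sum>k\<in>A. c k * wavelet_hat (j, k) \<xi>) = dilate j (\<lambda>\<xi>. indicator K \<xi> * cnj (trig_sum A (\<lambda>k. cnj (c k)) \<xi>)) \<xi>"
  by (simp add: wavelet_hat_def dilate_def trig_sum_def sum_distrib_left mult_ac)

lemma periodized_minus_cnj_trig_sum:
  "periodized (\<lambda>x. u x - cnj (trig_sum A c x)) x = periodized u x - cnj (trig_sum A c x)"
proof -
  have "trig_sum A c (x + of_int k) = trig_sum A c x" for k :: int
  proof -
    have "harmonic (of_int l * (x + of_int k)) = harmonic (of_int l * x)" for l :: int
      using harmonic_add_int[of "of_int l * x" "l * k"] by (simp add: distrib_left)
    then show ?thesis by (simp add: trig_sum_def)
  qed
  then show ?thesis by (simp add: periodized_def)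
qed

text \<open>At a fixed scale the functions are orthonormal, since dilation and periodization turn their
combinations into trigonometric sums of the same norm.\<close>

lemma energy_sum_wavelet_hat:
  assumes "finite A"
  shows "energy lebesgue (\<lambda>\<xi>. \<Sum>k\<in>A. c k * wavelet_hat (j, k) \<xi>) = ennreal (\<Sum>k\<in>A. (cmod (c k))\<^sup>2)"
proof -
  let ?T = "trig_sum A (\<lambda>k. cnj (c k))"
  interpret finite_measure period by (rule finite_measure_period)
  have T: "?T \<in> borel_measurable lebesgue" "?T \<in> borel_measurable period"
    by (auto intro!: borel_measurable_lebesgueI borel_measurable_periodI borel_measurable_trig_sum)
  then have m: "(\<lambda>\<xi>. - cnj (?T \<xi>)) \<in> borel_measurable lebesgue"
     "(\<lambda>\<xi>. indicator K \<xi> * cnj (?T \<xi>)) \<in> borel_measurable lebesgue"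
    using K_measurable by measurable
  have sq: "integrable period (\<lambda>x. (cmod (?T x))\<^sup>2)"
    by (rule integrable_const_bound[where B = "(\<Sum>k\<in>A. cmod (cnj (c k)))\<^sup>2"])
       (use T in \<open>auto intro!: power_mono norm_trig_sum_le AE_I2 simp del: complex_mod_cnj\<close>)
  have "energy lebesgue (\<lambda>\<xi>. \<Sum>k\<in>A. c k * wavelet_hat (j, k) \<xi>) = energy lebesgue (\<lambda>\<xi>. indicator K \<xi> * cnj (?T \<xi>))"
    unfolding sum_wavelet_hat by (rule energy_dilate[OF m(2)])
  also have "\<dots> = energy lebesgue (\<lambda>\<xi>. indicator K \<xi> * (0 - cnj (?T \<xi>)))"
    by (rule energy_cong_AE) (simp add: norm_mult)
  also have "\<dots> = energy period (periodized (\<lambda>\<xi>. 0 - cnj (?T \<xi>)))"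
    using m by (intro energy_periodized) simp
  also have "\<dots> = energy period ?T"
    using periodized_minus_cnj_trig_sum[of "\<lambda>_. 0" A "\<lambda>k. cnj (c k)"]
    by (intro energy_cong_AE) (simp only: periodized_def[of "\<lambda>_. 0"], simp)
  also have "\<dots> = ennreal (\<Sum>k\<in>A. (cmod (c k))\<^sup>2)"
    using integral_norm_trig_sum_square[OF assms, of "\<lambda>k. cnj (c k)"] by (simp add: energy_eq_integral[OF sq])
  finally show ?thesis .
qed

lemma wavelet_hat_L2: "wavelet_hat i \<in> L2"
proof -
  have "(\<lambda>\<xi>. indicator K \<xi> * harmonic (- (of_int (snd i) * \<xi>))) \<in> borel_measurable lebesgue"
    using K_measurable by measurable
  moreover have "energy lebesgue (wavelet_hat i) < \<infinity>"
    using energy_sum_wavelet_hat[of "{snd i}" "\<lambda>_. 1" "fst i"] by simp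
  ultimately show ?thesis
    by (simp add: L2_iff wavelet_hat_def energy_dilate(1))
qed

definition dilated :: "int \<Rightarrow> real set" where
  "dilated j = {\<xi>. 2 powi (- j) * \<xi> \<in> K}"

lemma wavelet_hat_outside: "\<xi> \<notin> dilated j \<Longrightarrow> wavelet_hat (j, k) \<xi> = 0"
  by (simp add: wavelet_hat_def dilate_def dilated_def)

lemma dilated_disjoint:
  assumes "\<xi> \<in> dilated i" "\<xi> \<in> dilated j"
  shows "i = j"
proof -
  have "2 powi (- i) * \<xi> > 0" using assms(1) K_positive by (auto simp: dilated_def)
  then have "\<xi> > 0" by (rule zero_less_mult_pos) (rule zero_less_power_int, simp)
  from dilation_tile[OF this] have "- i = - j"
    using assms unfolding dilated_def by blast
  then show ?thesis by simp
qed

lemma dilated_cover: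
  assumes "\<xi> > 0"
  obtains j where "\<xi> \<in> dilated j"
  using dilation_tile[OF assms] unfolding dilated_def by (metis mem_Collect_eq minus_minus)

text \<open>Different scales have disjoint supports. At the same scale all norms of combinations are known,
and polarization gives the inner products.\<close>

lemma L2_inner_wavelet_hat:
  "L2_inner (wavelet_hat i) (wavelet_hat i') = (if i = i' then 1 else 0)"
proof -
  obtain j k j' k' where i: "i = (j, k)" "i' = (j', k')" by (cases i; cases i')
  have sq: "(LINT \<xi>|lebesgue. (cmod (\<Sum>k\<in>A. c k * wavelet_hat (j, k) \<xi>))\<^sup>2) = (\<Sum>k\<in>A. (cmod (c k))\<^sup>2)"
    if A: "finite A" for A c j
  proof -
    have "(\<lambda>\<xi>. \<Sum>k\<in>A. c k * wavelet_hat (j, k) \<xi>) \<in> L2"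
      using A by (induction A rule: finite_induct)
        (auto simp: L2_def[THEN eqset_imp_iff, of "\<lambda>_. 0"] intro!: L2_add L2_scale wavelet_hat_L2)
    then show ?thesis
      using energy_sum_wavelet_hat[OF A, of c j] energy_eq_integral
      by (subst (asm) energy_eq_integral) (auto simp: L2_def sum_nonneg)
  qed
  have norm1: "(LINT \<xi>|lebesgue. (cmod (wavelet_hat (j, k) \<xi>))\<^sup>2) = 1" for j k
    using sq[of "{k}" "\<lambda>_. 1" j] by simp
  consider "i = i'" | "j \<noteq> j'" | "j = j'" "k \<noteq> k'" using i by auto
  then show ?thesis
  proof cases
    case 1
    have "L2_inner (wavelet_hat i) (wavelet_hat i) = (LINT \<xi>|lebesgue. of_real ((cmod (wavelet_hat i \<xi>))\<^sup>2))"
      unfolding L2_inner_def by (simp add: complex_norm_square del: of_real_power)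
    also have "\<dots> = 1" unfolding integral_complex_of_real i(1) norm1 by simp
    finally show ?thesis using 1 by simp
  next
    case 2
    then have zero: "wavelet_hat i \<xi> * cnj (wavelet_hat i' \<xi>) = 0" for \<xi>
      using dilated_disjoint[of \<xi> j j'] wavelet_hat_outside[of \<xi> j k] wavelet_hat_outside[of \<xi> j' k'] i
      by auto
    show ?thesis unfolding L2_inner_def zero using 2 i by simp
  next
    case 3
    have "Re (cnj c * L2_inner (wavelet_hat i) (wavelet_hat i')) = 0" for c
      using integral_norm_add_square[OF wavelet_hat_L2 wavelet_hat_L2, of i c i']
        sq[of "{k, k'}" "\<lambda>l. if l = k then 1 else c" j] norm1[of j k] norm1[of j' k'] 3 i
      by simp
    from this[of 1] this[of \<i>] show ?thesis using 3 i by (simp add: complex_eq_iff)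
  qed
qed

lemma dilate_inverse: "dilate j (dilate (- j) g) \<xi> = g \<xi>"
proof -
  have "2 powr (- real_of_int j / 2) * 2 powr (- real_of_int (- j) / 2) = (1::real)"
    by (simp add: powr_add[symmetric])
  moreover have "(2::real) powi (- (- j)) * (2 powi (- j) * \<xi>) = \<xi>"
    by (simp add: power_int_minus)
  ultimately show ?thesis
    unfolding dilate_def by (simp only: mult.assoc[symmetric] of_real_mult[symmetric]) simp
qed

text \<open>Dilate back to \<open>K\<close>, periodize, and approximate by a trigonometric sum. As \<open>wavelet_hat\<close> carries
the frequencies with a minus sign, the complex conjugate is approximated instead.\<close>

lemma wavelet_hat_dense_dilated:
  assumes g: "g \<in> L2" and e: "e > (0::real)"
  obtains A c where "finite A"
    "energy lebesgue (\<lambda>\<xi>. indicator (dilated j) \<xi> * g \<xi> - (\<Sum>k\<in>A. c k * wavelet_hat (j, k) \<xi>)) < ennreal e"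
proof -
  define u where "u = dilate (- j) g"
  have gm: "g \<in> borel_measurable lebesgue" and gfin: "energy lebesgue g < \<infinity>"
    using g by (auto simp: L2_iff)
  have um: "u \<in> borel_measurable lebesgue" and ufin: "energy lebesgue u < \<infinity>"
    using energy_dilate[OF gm, of "- j"] gfin by (auto simp: u_def)
  define v where "v x = cnj (periodized u x)" for x
  have vm: "v \<in> borel_measurable lebesgue"
    unfolding v_def by (intro borel_measurable_cnj borel_measurable_periodized um)
  have "energy period v = energy period (periodized u)"
    by (rule energy_cong_AE) (simp add: v_def)
  also have "\<dots> = energy lebesgue (\<lambda>x. indicator K x * u x)"
    by (rule energy_periodized[OF um, symmetric])
  also have "\<dots> \<le> energy lebesgue u"
    unfolding energy_def by (intro nn_integral_mono) (auto simp: indicator_def)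
  finally have "energy period v < \<infinity>" using ufin by (rule le_less_trans)
  then obtain A c where A: "finite A" and close: "energy period (\<lambda>x. v x - trig_sum A c x) < ennreal e"
    using trig_sums_dense_period[OF vm _ e] by blast
  have Tm: "(\<lambda>x. cnj (trig_sum A c x)) \<in> borel_measurable lebesgue"
    by (intro borel_measurable_cnj borel_measurable_lebesgueI borel_measurable_trig_sum)
  have "indicator (dilated j) \<xi> * g \<xi> - (\<Sum>k\<in>A. cnj (c k) * wavelet_hat (j, k) \<xi>)
     = dilate j (\<lambda>\<xi>. indicator K \<xi> * (u \<xi> - cnj (trig_sum A c \<xi>))) \<xi>" for \<xi>
  proof -
    have "indicator (dilated j) \<xi> * g \<xi> = dilate j (\<lambda>\<xi>. indicator K \<xi> * u \<xi>) \<xi>"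
      using dilate_inverse[of j g \<xi>] by (auto simp: u_def dilated_def dilate_def[of j] indicator_def)
    then show ?thesis
      by (simp add: sum_wavelet_hat dilate_def right_diff_distrib)
  qed
  then have "energy lebesgue (\<lambda>\<xi>. indicator (dilated j) \<xi> * g \<xi> - (\<Sum>k\<in>A. cnj (c k) * wavelet_hat (j, k) \<xi>))
     = energy lebesgue (dilate j (\<lambda>\<xi>. indicator K \<xi> * (u \<xi> - cnj (trig_sum A c \<xi>))))"
    by simp
  also have "\<dots> = energy lebesgue (\<lambda>\<xi>. indicator K \<xi> * (u \<xi> - cnj (trig_sum A c \<xi>)))"
    by (intro energy_dilate(2) borel_measurable_times borel_measurable_indicator K_measurable
        borel_measurable_diff um Tm)
  also have "\<dots> = energy period (periodized (\<lambda>\<xi>. u \<xi> - cnj (trig_sum A c \<xi>)))"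
    by (intro energy_periodized borel_measurable_diff um Tm)
  also have "\<dots> = energy period (\<lambda>x. v x - trig_sum A c x)"
  proof (rule energy_cong_AE, rule AE_I2)
    fix x
    have "v x - trig_sum A c x = cnj (periodized u x - cnj (trig_sum A c x))" by (simp add: v_def)
    then show "cmod (periodized (\<lambda>\<xi>. u \<xi> - cnj (trig_sum A c \<xi>)) x) = cmod (v x - trig_sum A c x)"
      by (simp only: periodized_minus_cnj_trig_sum complex_mod_cnj)
  qed
  finally show ?thesis using close A that[of A "\<lambda>k. cnj (c k)"] by simp
qed

lemma dilated_measurable: "dilated j \<in> sets lebesgue"
proof -
  have "(\<lambda>\<xi>::real. 2 powi (- j) * \<xi>) \<in> lebesgue \<rightarrow>\<^sub>M lebesgue"
    using measurable_lebesgue_affine[of "2 powi (- j)" 0] by simp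
  from measurable_sets[OF this K_measurable] show ?thesis
    by (simp add: dilated_def vimage_def)
qed

lemma outside_dilated_measurable:
  assumes "finite J"
  shows "- (\<Union>j\<in>J. dilated j) \<in> sets lebesgue"
proof -
  have "(\<Union>j\<in>J. dilated j) \<in> sets lebesgue"
    using assms by (intro sets.finite_UN dilated_measurable)
  from sets.compl_sets[OF this] show ?thesis by (simp add: Compl_eq_Diff_UNIV)
qed

lemma energy_outside_dilated_tendsto_0:
  assumes g: "g \<in> L2" and pos: "AE \<xi> in lebesgue. \<xi> \<le> 0 \<longrightarrow> g \<xi> = 0"
  shows "(\<lambda>n. energy lebesgue (\<lambda>\<xi>. indicator (- (\<Union>j\<in>{- int n..int n}. dilated j)) \<xi> * g \<xi>)) \<longlonglongrightarrow> 0"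
proof -
  have gm [measurable]: "g \<in> borel_measurable lebesgue" and gfin: "energy lebesgue g < \<infinity>"
    using g by (auto simp: L2_iff)
  let ?U = "\<lambda>n::nat. - (\<Union>j\<in>{- int n..int n}. dilated j)"
  have U: "?U n \<in> sets lebesgue" for n
    by (rule outside_dilated_measurable) simp
  have "(\<lambda>n. \<integral>\<^sup>+\<xi>. ennreal ((cmod (indicator (?U n) \<xi> * g \<xi>))\<^sup>2) \<partial>lebesgue) \<longlonglongrightarrow> (\<integral>\<^sup>+(\<xi>::real). 0 \<partial>lebesgue)"
  proof (rule nn_integral_dominated_convergence[where w = "\<lambda>\<xi>. ennreal ((cmod (g \<xi>))\<^sup>2)"])
    have "(\<lambda>\<xi>. indicator (?U n) \<xi> * g \<xi>) \<in> borel_measurable lebesgue" for n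
      by (rule borel_measurable_times[OF borel_measurable_indicator[OF U] gm])
    then show "(\<lambda>\<xi>. ennreal ((cmod (indicator (?U n) \<xi> * g \<xi>))\<^sup>2)) \<in> borel_measurable lebesgue" for n
      by measurable
    show "AE \<xi> in lebesgue. (\<lambda>n. ennreal ((cmod (indicator (?U n) \<xi> * g \<xi>))\<^sup>2)) \<longlonglongrightarrow> 0"
      using pos
    proof eventually_elim
      case (elim \<xi>)
      show ?case
      proof (cases "\<xi> > 0")
        case True
        obtain j where j: "\<xi> \<in> dilated j" using dilated_cover[OF True] .
        show ?thesis
        proof (rule tendsto_eventually, use eventually_ge_at_top[of "nat \<bar>j\<bar>"] in eventually_elim)
          case (elim n)
          then have "j \<in> {- int n..int n}" by auto
          then have "\<xi> \<notin> ?U n" using j by blast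
          then show ?case by simp
        qed
      qed (use elim in simp)
    qed
  qed (use gfin in \<open>auto simp: energy_def indicator_def\<close>)
  then show ?thesis by (simp add: energy_def)
qed

text \<open>Only finitely many scales matter up to an error \<open>e/2\<close>. Their supports are disjoint, so the
squared errors of the approximations at these scales add up, and \<open>e/2\<close> is divided evenly among
them.\<close>

lemma wavelet_hat_dense:
  assumes g: "g \<in> L2" and pos: "AE \<xi> in lebesgue. \<xi> \<le> 0 \<longrightarrow> g \<xi> = 0" and e: "e > (0::real)"
  obtains F c where "finite F" "L2_dist_sq g (\<lambda>\<xi>. \<Sum>i\<in>F. c i * wavelet_hat i \<xi>) < ennreal e"
proof -
  have gm [measurable]: "g \<in> borel_measurable lebesgue" using g by (simp add: L2_iff)
  have "eventually (\<lambda>n. energy lebesgue (\<lambda>\<xi>. indicator (- (\<Union>j\<in>{- int n..int n}. dilated j)) \<xi> * g \<xi>) < ennreal (e/2)) sequentially"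
    using e by (intro order_tendstoD(2)[OF energy_outside_dilated_tendsto_0[OF g pos]]) simp
  then obtain n where n: "energy lebesgue (\<lambda>\<xi>. indicator (- (\<Union>j\<in>{- int n..int n}. dilated j)) \<xi> * g \<xi>) < ennreal (e/2)"
    by (meson eventually_sequentially order_refl)
  define J where "J = {- int n..int n}"
  define d where "d = e / 2 / real (card J)"
  have "finite J" and "card J > 0" by (auto simp: J_def)
  then have "d > 0" using e by (simp add: d_def)
  define good where "good j Ac \<longleftrightarrow> finite (fst Ac) \<and>
     energy lebesgue (\<lambda>\<xi>. indicator (dilated j) \<xi> * g \<xi> - (\<Sum>k\<in>fst Ac. snd Ac k * wavelet_hat (j, k) \<xi>)) < ennreal d" for j Ac
  have "\<exists>Ac. good j Ac" for j
  proof -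
    obtain A c where "finite A"
      "energy lebesgue (\<lambda>\<xi>. indicator (dilated j) \<xi> * g \<xi> - (\<Sum>k\<in>A. c k * wavelet_hat (j, k) \<xi>)) < ennreal d"
      by (rule wavelet_hat_dense_dilated[OF g \<open>d > 0\<close>])
    then have "good j (A, c)" by (simp add: good_def)
    then show ?thesis ..
  qed
  then have "\<forall>j. \<exists>Ac. good j Ac" by (rule allI)
  from choice[OF this] obtain Ac where Ac: "\<And>j. good j (Ac j)" by (elim exE) (rule that, erule spec)
  define A where "A j = fst (Ac j)" for j
  define c where "c i = snd (Ac (fst i)) (snd i)" for i
  define T where "T j \<xi> = (\<Sum>k\<in>A j. c (j, k) * wavelet_hat (j, k) \<xi>)" for j \<xi>
  have A: "finite (A j)"
    and close: "energy lebesgue (\<lambda>\<xi>. indicator (dilated j) \<xi> * g \<xi> - T j \<xi>) < ennreal d" for j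
    using Ac[of j] by (auto simp: good_def A_def c_def T_def)
  have Tm: "T j \<in> borel_measurable lebesgue" for j
    unfolding T_def[abs_def] using wavelet_hat_L2
    by (intro borel_measurable_sum borel_measurable_times borel_measurable_const) (auto simp: L2_iff)
  have T_outside: "T j \<xi> = 0" if "\<xi> \<notin> dilated j" for j \<xi>
    using wavelet_hat_outside[OF that] by (simp add: T_def)
  define F where "F = Sigma J A"
  have "finite F" unfolding F_def using A \<open>finite J\<close> by auto
  have sumF: "(\<Sum>i\<in>F. c i * wavelet_hat i \<xi>) = (\<Sum>j\<in>J. T j \<xi>)" for \<xi>
    unfolding F_def T_def using A \<open>finite J\<close> by (subst sum.Sigma) (auto simp: case_prod_beta)
  let ?rest = "\<lambda>\<xi>. indicator (- (\<Union>j\<in>J. dilated j)) \<xi> * g \<xi>"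
  let ?err = "\<lambda>j \<xi>. indicator (dilated j) \<xi> * g \<xi> - T j \<xi>"
  have pointwise: "(cmod (g \<xi> - (\<Sum>j\<in>J. T j \<xi>)))\<^sup>2 \<le> (cmod (?rest \<xi>))\<^sup>2 + (\<Sum>j\<in>J. (cmod (?err j \<xi>))\<^sup>2)" for \<xi>
  proof (cases "\<exists>i\<in>J. \<xi> \<in> dilated i")
    case True
    then obtain i where i: "i \<in> J" "\<xi> \<in> dilated i" by blast
    have "(\<Sum>j\<in>J. T j \<xi>) = (\<Sum>j\<in>J. if j = i then T i \<xi> else 0)"
      using dilated_disjoint[OF i(2)] T_outside by (intro sum.cong) auto
    then have "g \<xi> - (\<Sum>j\<in>J. T j \<xi>) = ?err i \<xi>"
      using i \<open>finite J\<close> by simp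
    also have "(cmod (?err i \<xi>))\<^sup>2 \<le> (\<Sum>j\<in>J. (cmod (?err j \<xi>))\<^sup>2)"
      using i(1) \<open>finite J\<close> by (intro member_le_sum) auto
    finally show ?thesis by (simp add: add_increasing)
  next
    case False
    then have "(\<Sum>j\<in>J. T j \<xi>) = 0" using T_outside by (intro sum.neutral) auto
    then show ?thesis using False by (simp add: sum_nonneg)
  qed
  have Dm: "(\<lambda>\<xi>. indicator B \<xi> * g \<xi>) \<in> borel_measurable lebesgue" if "B \<in> sets lebesgue" for B
    by (rule borel_measurable_times[OF borel_measurable_indicator[OF that] gm])
  have m: "?rest \<in> borel_measurable lebesgue" "\<And>j. ?err j \<in> borel_measurable lebesgue"
  proof -
    show "?rest \<in> borel_measurable lebesgue"
      by (rule Dm[OF outside_dilated_measurable[OF \<open>finite J\<close>]])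
    show "?err j \<in> borel_measurable lebesgue" for j
      by (intro borel_measurable_diff Dm dilated_measurable Tm)
  qed
  have m2: "(\<lambda>\<xi>. ennreal ((cmod (u \<xi>))\<^sup>2)) \<in> borel_measurable lebesgue" if "u \<in> borel_measurable lebesgue" for u :: "real \<Rightarrow> complex"
    using that by measurable
  have "L2_dist_sq g (\<lambda>\<xi>. \<Sum>i\<in>F. c i * wavelet_hat i \<xi>) = (\<integral>\<^sup>+\<xi>. ennreal ((cmod (g \<xi> - (\<Sum>j\<in>J. T j \<xi>)))\<^sup>2) \<partial>lebesgue)"
    by (simp add: L2_dist_sq_def sumF)
  also have "\<dots> \<le> (\<integral>\<^sup>+\<xi>. ennreal ((cmod (?rest \<xi>))\<^sup>2) + (\<Sum>j\<in>J. ennreal ((cmod (?err j \<xi>))\<^sup>2)) \<partial>lebesgue)"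
  proof (rule nn_integral_mono)
    fix \<xi>
    have "ennreal ((cmod (g \<xi> - (\<Sum>j\<in>J. T j \<xi>)))\<^sup>2) \<le> ennreal ((cmod (?rest \<xi>))\<^sup>2 + (\<Sum>j\<in>J. (cmod (?err j \<xi>))\<^sup>2))"
      by (rule ennreal_leI[OF pointwise])
    also have "\<dots> = ennreal ((cmod (?rest \<xi>))\<^sup>2) + (\<Sum>j\<in>J. ennreal ((cmod (?err j \<xi>))\<^sup>2))"
      by (subst ennreal_plus) (auto intro!: sum_nonneg)
    finally show "ennreal ((cmod (g \<xi> - (\<Sum>j\<in>J. T j \<xi>)))\<^sup>2)
       \<le> ennreal ((cmod (?rest \<xi>))\<^sup>2) + (\<Sum>j\<in>J. ennreal ((cmod (?err j \<xi>))\<^sup>2))" .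
  qed
  also have "\<dots> = energy lebesgue ?rest + (\<Sum>j\<in>J. energy lebesgue (?err j))"
    unfolding energy_def
    by (subst nn_integral_add[OF m2[OF m(1)] borel_measurable_sum[OF m2[OF m(2)]]])
       (subst nn_integral_sum[OF m2[OF m(2)]], simp)
  also have "\<dots> \<le> energy lebesgue ?rest + (\<Sum>j\<in>J. ennreal d)"
    using close by (intro add_left_mono sum_mono) (rule less_imp_le)
  also have "(\<Sum>j\<in>J. ennreal d) = ennreal (e/2)"
    using \<open>card J > 0\<close> e by (simp add: d_def ennreal_of_nat_eq_real_of_nat ennreal_mult[symmetric])
  also have "energy lebesgue ?rest + ennreal (e/2) < ennreal (e/2) + ennreal (e/2)"
    using n unfolding J_def by (subst (1 2) add.commute[of _ "ennreal (e/2)"]) (simp add: ennreal_add_left_cancel_less)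
  also have "\<dots> = ennreal e" using e by (simp add: ennreal_plus[symmetric] del: ennreal_plus)
  finally show ?thesis using \<open>finite F\<close> that by blast
qed

section \<open>The wavelet of a tile\<close>

definition wavelet :: "real \<Rightarrow> complex" where
  "wavelet x = fourier_integral (indicator K) (- x)"

text \<open>Translations become modulations and dilations become inverse dilations: substitute \<open>\<xi> = 2\<^sup>j \<eta>\<close>
in the inverse Fourier integral.\<close>

lemma dyadic_system_wavelet:
  "dyadic_system wavelet i x = fourier_integral (wavelet_hat i) (- x)"
proof -
  obtain j k where i: "i = (j, k)" by (cases i)
  have pos: "(2::real) powi j > 0" by simp
  have half: "2 powi j * 2 powr (- real_of_int j / 2) = 2 powr (real_of_int j / 2)"
    unfolding powr_half_square[symmetric] power2_eq_square by (simp add: powr_add[symmetric])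
  have "fourier_integral (wavelet_hat i) (- x)
     = 2 powi j *\<^sub>R (LINT \<eta>|lebesgue. wavelet_hat i (0 + 2 powi j * \<eta>) * harmonic (- ((0 + 2 powi j * \<eta>) * - x)))"
    unfolding fourier_integral_def using pos
    by (subst lebesgue_integral_real_affine[of "2 powi j" _ 0]) auto
  also have "(\<lambda>\<eta>. wavelet_hat i (0 + 2 powi j * \<eta>) * harmonic (- ((0 + 2 powi j * \<eta>) * - x)))
     = (\<lambda>\<eta>. of_real (2 powr (- real_of_int j / 2)) *
         (indicator K \<eta> * harmonic (- (\<eta> * - (2 powi j * x - of_int k)))))"
  proof
    fix \<eta> :: real
    have undo: "2 powi (- j) * (0 + 2 powi j * \<eta>) = \<eta>" by (simp add: power_int_minus)
    have "wavelet_hat i (0 + 2 powi j * \<eta>) =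
        of_real (2 powr (- real_of_int j / 2)) * (indicator K \<eta> * harmonic (- (of_int k * \<eta>)))"
      unfolding i wavelet_hat_def dilate_def fst_conv snd_conv undo ..
    moreover have "harmonic (- (of_int k * \<eta>)) * harmonic (- ((0 + 2 powi j * \<eta>) * - x))
        = harmonic (- (\<eta> * - (2 powi j * x - of_int k)))"
      unfolding harmonic_add[symmetric] by (rule arg_cong[where f = harmonic]) (simp add: algebra_simps)
    ultimately show "wavelet_hat i (0 + 2 powi j * \<eta>) * harmonic (- ((0 + 2 powi j * \<eta>) * - x))
      = of_real (2 powr (- real_of_int j / 2)) * (indicator K \<eta> * harmonic (- (\<eta> * - (2 powi j * x - of_int k))))"
      by (simp only: mult.assoc)
  qed
  also have "2 powi j *\<^sub>R (LINT \<eta>|lebesgue. of_real (2 powr (- real_of_int j / 2)) *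
         (indicator K \<eta> * harmonic (- (\<eta> * - (2 powi j * x - of_int k)))))
     = of_real (2 powi j * 2 powr (- real_of_int j / 2)) * wavelet (2 powi j * x - of_int k)"
    unfolding wavelet_def fourier_integral_def integral_mult_right_zero
    by (simp only: scaleR_conv_of_real of_real_mult mult.assoc)
  also have "\<dots> = dyadic_system wavelet i x"
    unfolding half i dyadic_system_def by simp
  finally show ?thesis by simp
qed

lemma dyadic_system_wavelet_transform: "has_fourier_transform (dyadic_system wavelet i) (wavelet_hat i)"
proof -
  obtain B where B: "\<And>x. x \<in> K \<Longrightarrow> \<bar>x\<bar> \<le> B"
    using K_bounded unfolding bounded_iff by auto
  have "wavelet_hat i \<xi> = 0" if "\<bar>\<xi>\<bar> > 2 powi (fst i) * B" for \<xi>
  proof -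
    have "\<xi> \<notin> dilated (fst i)"
    proof
      assume "\<xi> \<in> dilated (fst i)"
      then have "\<bar>2 powi (- fst i) * \<xi>\<bar> \<le> B" using B by (simp add: dilated_def)
      then show False using that by (simp add: power_int_minus abs_mult field_simps)
    qed
    then show ?thesis using wavelet_hat_outside[of \<xi> "fst i" "snd i"] by simp
  qed
  from fourier_inversion_compact_support[OF wavelet_hat_L2 this]
  show ?thesis by (simp add: dyadic_system_wavelet[abs_def])
qed

lemma wavelet_eq_dyadic: "wavelet = dyadic_system wavelet (0, 0)"
  by (simp add: dyadic_system_def)

lemma indicator_eq_wavelet_hat: "indicator K = wavelet_hat (0, 0)"
  by (simp add: wavelet_hat_def dilate_def fun_eq_iff)

lemma wavelet_transform: "has_fourier_transform wavelet (indicator K)"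
  using dyadic_system_wavelet_transform[of "(0, 0)"] by (simp add: wavelet_eq_dyadic[symmetric] indicator_eq_wavelet_hat)

lemma dyadic_system_wavelet_H2: "dyadic_system wavelet i \<in> H2"
proof -
  have "wavelet_hat i \<xi> = 0" if "\<xi> \<le> 0" for \<xi>
  proof -
    have "2 powi (- fst i) * \<xi> \<le> 0" using that by (simp add: mult_le_0_iff)
    then have "\<xi> \<notin> dilated (fst i)" using K_positive by (auto simp: dilated_def)
    then show ?thesis using wavelet_hat_outside[of \<xi> "fst i" "snd i"] by simp
  qed
  then show ?thesis
    using dyadic_system_wavelet_transform[of i] has_fourier_transform_L2
    by (auto simp: H2_def)
qed

theorem H2_wavelet_wavelet: "H2_wavelet wavelet"
proof -
  have dense: "\<exists>F c. finite F \<and> L2_dist_sq f (\<lambda>x. \<Sum>i\<in>F. c i * dyadic_system wavelet i x) < \<epsilon>"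
    if f: "f \<in> H2" and "\<epsilon> > 0" for f \<epsilon>
  proof -
    obtain g where g: "has_fourier_transform f g" "AE \<xi> in lebesgue. \<xi> \<le> 0 \<longrightarrow> g \<xi> = 0"
      using f by (auto simp: H2_def)
    obtain e :: real where "e > 0" "ennreal e \<le> \<epsilon>"
    proof (cases \<epsilon>)
      case (real r)
      then show ?thesis using that[of r] \<open>\<epsilon> > 0\<close> by auto
    qed (use that[of 1] in auto)
    obtain F c where F: "finite F" "L2_dist_sq g (\<lambda>\<xi>. \<Sum>i\<in>F. c i * wavelet_hat i \<xi>) < ennreal e"
      using wavelet_hat_dense[OF has_fourier_transform_L2(2)[OF g(1)] g(2) \<open>e > 0\<close>] by blast
    have "L2_dist_sq f (\<lambda>x. \<Sum>i\<in>F. c i * dyadic_system wavelet i x) = L2_dist_sq g (\<lambda>\<xi>. \<Sum>i\<in>F. c i * wavelet_hat i \<xi>)"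
      by (intro L2_dist_sq_fourier_transform g has_fourier_transform_sum F dyadic_system_wavelet_transform)
    then have "L2_dist_sq f (\<lambda>x. \<Sum>i\<in>F. c i * dyadic_system wavelet i x) < \<epsilon>"
      using F(2) \<open>ennreal e \<le> \<epsilon>\<close> by (simp add: less_le_trans)
    then show ?thesis using F(1) by blast
  qed
  have "L2_inner (dyadic_system wavelet i) (dyadic_system wavelet i') = (if i = i' then 1 else 0)" for i i'
    using L2_inner_fourier_transform[OF dyadic_system_wavelet_transform dyadic_system_wavelet_transform]
      L2_inner_wavelet_hat by simp
  then have "L2_orthonormal_basis H2 (dyadic_system wavelet)"
    unfolding L2_orthonormal_basis_def using dense dyadic_system_wavelet_H2 by blast
  then show ?thesis
    using dyadic_system_wavelet_H2[of "(0, 0)"] by (simp add: H2_wavelet_def wavelet_eq_dyadic[symmetric])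
qed

text \<open>The modulus of a transform is prescribed almost everywhere only, so the exact tile \<open>K\<close> may be
replaced by a set \<open>L\<close> that tiles up to null sets.\<close>

theorem H2_wavelet_set_of_tile:
  assumes "L \<in> sets lebesgue" "L \<subseteq> {0<..}" and "AE x in lebesgue. x \<in> K \<longleftrightarrow> x \<in> L"
  shows "H2_wavelet_set L"
proof -
  have "AE \<xi> in lebesgue. cmod (indicator K \<xi>) = indicator L \<xi>"
    using assms(3) by eventually_elim (auto simp: indicator_def)
  then show ?thesis
    unfolding H2_wavelet_set_def using assms H2_wavelet_wavelet wavelet_transform by blast
qed

end

section \<open>The intervals of a polygonal\<close>

lemma increasing_partition:
  fixes f :: "nat \<Rightarrow> real"
  assumes mono: "\<And>i j. i < j \<Longrightarrow> j \<le> n \<Longrightarrow> f i < f j" and x: "f 0 \<le> x" "x < f n"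
  shows "\<exists>!j. j \<in> {1..n} \<and> f (j - 1) \<le> x \<and> x < f j"
proof -
  define j where "j = (LEAST j. x < f j)"
  have xj: "x < f j" unfolding j_def using x(2) by (rule LeastI)
  have "j \<le> n" unfolding j_def using x(2) by (rule Least_le)
  have "j \<noteq> 0" using xj x(1) by (intro notI) simp
  have least: "f (j - 1) \<le> x"
    using not_less_Least[of "j - 1" "\<lambda>j. x < f j"] \<open>j \<noteq> 0\<close> unfolding j_def by fastforce
  show ?thesis
  proof (rule ex1I[of _ j])
    show "j \<in> {1..n} \<and> f (j - 1) \<le> x \<and> x < f j"
      using xj least \<open>j \<le> n\<close> \<open>j \<noteq> 0\<close> by auto
  next
    fix i assume i: "i \<in> {1..n} \<and> f (i - 1) \<le> x \<and> x < f i"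
    have "j \<le> i" unfolding j_def using i by (intro Least_le) auto
    moreover have "\<not> j < i"
    proof
      assume "j < i"
      then have "f j \<le> f (i - 1)"
        using mono[of j "i - 1"] i by (cases "j = i - 1") (auto simp: less_eq_real_def)
      then show False using xj i by linarith
    qed
    ultimately show "i = j" by simp
  qed
qed

lemma power_int_2_eq_iff: "(2::real) powi i = 2 powi j \<longleftrightarrow> i = j"
  using power_int_strict_increasing[of i j "2::real"] power_int_strict_increasing[of j i "2::real"]
  by (cases i j rule: linorder_cases) auto

text \<open>The dilates of \<open>[a, 2a)\<close> by different powers of 2 are disjoint.\<close>

lemma dyadic_interval_unique:
  assumes "a > 0" "a \<le> 2 powi i * x" "2 powi i * x < 2 * a" "a \<le> 2 powi j * x" "2 powi j * x < 2 * (a :: real)"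
  shows "i = j"
proof -
  have less: False if "i < j" "a \<le> 2 powi i * x" "2 powi j * x < 2 * a" for i j
  proof -
    have "2 powi j = 2 powi (i + 1) * (2::real) powi (j - i - 1)"
      by (subst power_int_add[symmetric]) auto
    moreover have "(1::real) \<le> 2 powi (j - i - 1)"
      using that(1) by (intro one_le_power_int) auto
    moreover have "2 * a \<le> 2 powi (i + 1) * x"
      using that(2) by (simp add: power_int_add)
    moreover have "2 powi (i + 1) * x * 1 \<le> 2 powi (i + 1) * x * 2 powi (j - i - 1)"
      using calculation \<open>a > 0\<close> by (intro mult_left_mono) auto
    ultimately show False using that(3) by (simp add: mult_ac)
  qed
  show ?thesis
    using less[of i j] less[of j i] assms by (cases i j rule: linorder_cases) auto
qed

lemma dyadic_interval_exists:
  assumes "a > 0" "x > 0"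
  obtains i :: int where "a \<le> 2 powi i * x" "2 powi i * x < 2 * (a :: real)"
proof -
  define r where "r = \<lfloor>log 2 (x / a)\<rfloor>"
  have "2 powr real_of_int r \<le> x / a"
    using assms by (subst le_log_iff[symmetric]) (auto simp: r_def)
  moreover have "x / a < 2 powr real_of_int (r + 1)"
    using assms by (subst log_less_iff[symmetric]) (auto simp: r_def)
  ultimately have "2 powi r * a \<le> x" "x < 2 powi (r + 1) * a"
    using assms(1) by (simp_all add: powr_real_of_int' pos_le_divide_eq pos_divide_less_eq del: of_int_add)
  then have "a \<le> 2 powi (- r) * x" "2 powi (- r) * x < 2 * a"
    by (simp_all add: power_int_minus power_int_add field_simps)
  with that show ?thesis .
qed

locale polygonal =
  fixes p :: "(int \<times> nat) list"
  assumes polygonal: "H2_MSF_polygonal p"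
begin

definition scale :: "nat \<Rightarrow> real" where
  "scale j = 2 powi (- lam p j)"

lemma scale_pos: "scale j > 0"
  by (simp add: scale_def)

lemma length_ge_1: "1 \<le> length p"
  and lam_1: "lam p 1 = 0"
  and mul_1: "mul p 1 = 0"
  and mul_step: "\<And>j. j \<in> {1..<length p} \<Longrightarrow> mul p j \<noteq> mul p (j + 1)"
  and last_denom: "(2::real) powi (- (lam p (length p) + 1)) - 1 \<noteq> 0"
  and denom: "\<And>j. j \<in> {1..<length p} \<Longrightarrow> scale j - scale (j + 1) \<noteq> 0"
  and knot_0: "0 < knot p 0" "knot p 0 < 1"
  and knot_step: "\<And>j. j < length p \<Longrightarrow> knot p j < knot p (j + 1)"
  using polygonal unfolding H2_MSF_polygonal_def Let_def scale_def by auto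

lemma knot_length: "knot p (length p) = knot p 0 + 1"
  using length_ge_1 by (auto simp: knot_def)

lemma knot_mono:
  assumes "i < j" "j \<le> length p"
  shows "knot p i < knot p j"
  using assms
proof (induction j)
  case (Suc j)
  then show ?case
    using knot_step[of j] by (cases "i = j") auto
qed simp

lemma knot_mono_le: "i \<le> j \<Longrightarrow> j \<le> length p \<Longrightarrow> knot p i \<le> knot p j"
  using knot_mono[of i j] by (cases "i = j") auto

text \<open>The formula for an interior knot says that consecutive scaled intervals are adjacent.\<close>

lemma scale_chain:
  assumes "j \<in> {1..<length p}"
  shows "scale j * (knot p j + mul p j) = scale (j + 1) * (knot p j + mul p (j + 1))"
proof -
  have "knot p j = - (real (mul p j) * scale j - real (mul p (j + 1)) * scale (j + 1)) / (scale j - scale (j + 1))"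
    using assms by (auto simp: knot_def scale_def)
  then have "knot p j * (scale j - scale (j + 1)) = - (real (mul p j) * scale j - real (mul p (j + 1)) * scale (j + 1))"
    by (rule iffD1[OF nonzero_eq_divide_eq[OF denom[OF assms]]])
  then show ?thesis by (simp only: algebra_simps)
qed

text \<open>The formula for \<open>a\<^sub>0\<close> says that the last scaled interval ends at \<open>2 a\<^sub>0\<close>.\<close>

lemma scale_wrap: "scale (length p) * (knot p (length p) + mul p (length p)) = 2 * knot p 0"
proof -
  define t where "t = (2::real) powi (- (lam p (length p) + 1))"
  have t: "scale (length p) = 2 * t"
    using power_int_add[of "2::real" "- (lam p (length p) + 1)" 1] by (simp add: t_def scale_def)
  have "knot p 0 = - ((real (mul p (length p)) + 1) * t) / (t - 1)"
    by (simp add: knot_def first_knot_def Let_def t_def)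
  then have "knot p 0 * (t - 1) = - ((real (mul p (length p)) + 1) * t)"
    by (rule iffD1[OF nonzero_eq_divide_eq[OF last_denom[folded t_def]]])
  then show ?thesis unfolding t knot_length by (simp add: algebra_simps)
qed

text \<open>The endpoints of the scaled intervals \<open>2\<^bsup>-\<lambda>\<^sub>j\<^esup> I\<^sub>j\<close>, which partition \<open>[a\<^sub>0, 2 a\<^sub>0]\<close>.\<close>

definition breakpoint :: "nat \<Rightarrow> real" where
  "breakpoint j = (if j = 0 then knot p 0 else scale j * (knot p j + mul p j))"

lemma breakpoint_left:
  assumes "j \<in> {1..length p}"
  shows "breakpoint (j - 1) = scale j * (knot p (j - 1) + mul p j)"
proof (cases "j = 1")
  case True
  then show ?thesis using lam_1 mul_1 by (simp add: breakpoint_def scale_def)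
next
  case False
  then have j: "j - 1 \<in> {1..<length p}" "j - 1 + 1 = j" "j - 1 \<noteq> 0" using assms by auto
  from scale_chain[OF j(1)] show ?thesis unfolding j(2) using j(3) by (simp add: breakpoint_def)
qed

lemma breakpoint_right: "j \<in> {1..length p} \<Longrightarrow> breakpoint j = scale j * (knot p j + mul p j)"
  by (simp add: breakpoint_def)

lemma breakpoint_length: "breakpoint (length p) = 2 * knot p 0"
  using scale_wrap length_ge_1 by (auto simp: breakpoint_def)

lemma breakpoint_mono:
  assumes "i < j" "j \<le> length p"
  shows "breakpoint i < breakpoint j"
  using assms
proof (induction j)
  case (Suc j)
  have "breakpoint j < breakpoint (Suc j)"
    using breakpoint_left[of "Suc j"] breakpoint_right[of "Suc j"] Suc.prems knot_step[of j] scale_pos[of "Suc j"]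
    by simp
  then show ?case using Suc by (cases "i = j") auto
qed simp

lemma breakpoint_mono_le: "i \<le> j \<Longrightarrow> j \<le> length p \<Longrightarrow> breakpoint i \<le> breakpoint j"
  using breakpoint_mono[of i j] by (cases "i = j") auto

lemma polygonal_interval_eq:
  "polygonal_interval p j = {knot p (j - 1) + mul p j..knot p j + mul p j}"
  by (simp add: polygonal_interval_def add.commute)

definition half_open :: "nat \<Rightarrow> real set" where
  "half_open j = {knot p (j - 1) + mul p j..<knot p j + mul p j}"

definition half_open_set :: "real set" where
  "half_open_set = (\<Union>j\<in>{1..length p}. half_open j)"

lemma unit_cell:
  assumes "knot p 0 \<le> t" "t < knot p 0 + 1"
  shows "\<exists>!j. j \<in> {1..length p} \<and> knot p (j - 1) \<le> t \<and> t < knot p j"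
  using assms by (intro increasing_partition knot_mono) (auto simp: knot_length)

lemma dyadic_cell:
  assumes "knot p 0 \<le> y" "y < 2 * knot p 0"
  shows "\<exists>!j. j \<in> {1..length p} \<and> breakpoint (j - 1) \<le> y \<and> y < breakpoint j"
  using assms by (intro increasing_partition breakpoint_mono) (auto simp: breakpoint_length breakpoint_def[of 0])

lemma cell_in_unit:
  assumes "j \<in> {1..length p}"
  shows "knot p 0 \<le> knot p (j - 1)" "knot p j \<le> knot p 0 + 1"
  using assms knot_mono_le[of 0 "j - 1"] knot_mono_le[of j "length p"] by (auto simp: knot_length)

text \<open>Removing the integer \<open>m\<^sub>j\<close> from a point of the \<open>j\<close>-th interval leads into \<open>[a\<^sub>0, a\<^sub>0 + 1)\<close>, where a
point is determined by its class modulo 1 and lies in only one piece.\<close>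

lemma half_open_set_translation: "\<exists>!k::int. x + of_int k \<in> half_open_set"
proof -
  define k0 where "k0 = - \<lfloor>x - knot p 0\<rfloor>"
  have "knot p 0 \<le> x + of_int k0" "x + of_int k0 < knot p 0 + 1"
    unfolding k0_def by linarith+
  from unit_cell[OF this] obtain j where j: "j \<in> {1..length p}" "knot p (j - 1) \<le> x + of_int k0" "x + of_int k0 < knot p j"
    by blast
  show ?thesis
  proof (rule ex_ex1I)
    have "x + of_int (k0 + int (mul p j)) \<in> half_open j"
      using j by (auto simp: half_open_def)
    then show "\<exists>k::int. x + of_int k \<in> half_open_set"
      using j(1) unfolding half_open_set_def by blast
  next
    fix k l :: int
    assume "x + of_int k \<in> half_open_set" "x + of_int l \<in> half_open_set"
    then obtain i i' where i: "i \<in> {1..length p}" "x + of_int k \<in> half_open i"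
      and i': "i' \<in> {1..length p}" "x + of_int l \<in> half_open i'"
      unfolding half_open_set_def by blast
    define t where "t = x + of_int (k - int (mul p i))"
    define t' where "t' = x + of_int (l - int (mul p i'))"
    have t: "knot p (i - 1) \<le> t" "t < knot p i" and t': "knot p (i' - 1) \<le> t'" "t' < knot p i'"
      using i(2) i'(2) by (auto simp: half_open_def t_def t'_def)
    have unit: "knot p 0 \<le> t" "t < knot p 0 + 1" "knot p 0 \<le> t'" "t' < knot p 0 + 1"
      using t t' cell_in_unit[OF i(1)] cell_in_unit[OF i'(1)] by linarith+
    then have "k - int (mul p i) = l - int (mul p i')"
      unfolding t_def t'_def by linarith
    moreover from this have "t = t'" by (simp add: t_def t'_def)
    then have "i = i'"
      using unit_cell[OF unit(1,2)] t t' i(1) i'(1) by blast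
    ultimately show "k = l" by simp
  qed
qed

lemma half_open_scaled:
  assumes "j \<in> {1..length p}"
  shows "2 powi k * x \<in> half_open j \<longleftrightarrow>
    breakpoint (j - 1) \<le> 2 powi (k - lam p j) * x \<and> 2 powi (k - lam p j) * x < breakpoint j"
proof -
  have eq: "2 powi (k - lam p j) * x = scale j * (2 powi k * x)"
    by (simp add: scale_def power_int_diff power_int_minus field_simps)
  show ?thesis
    unfolding eq half_open_def breakpoint_left[OF assms] breakpoint_right[OF assms]
    using scale_pos[of j] by (simp add: mult_le_cancel_left_pos mult_less_cancel_left_pos)
qed

text \<open>Scaling the \<open>j\<close>-th interval by \<open>2\<^bsup>-\<lambda>\<^sub>j\<^esup>\<close> leads into \<open>[a\<^sub>0, 2 a\<^sub>0)\<close>, which contains exactly one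
dyadic multiple of \<open>x\<close>, in only one of the scaled intervals.\<close>

lemma half_open_set_dilation:
  assumes "x > 0"
  shows "\<exists>!k::int. 2 powi k * x \<in> half_open_set"
proof -
  obtain r :: int where "knot p 0 \<le> 2 powi r * x" "2 powi r * x < 2 * knot p 0"
    using dyadic_interval_exists[OF knot_0(1) assms] .
  from dyadic_cell[OF this] obtain j where j: "j \<in> {1..length p}"
    "breakpoint (j - 1) \<le> 2 powi r * x" "2 powi r * x < breakpoint j" by blast
  show ?thesis
  proof (rule ex_ex1I)
    have "2 powi (r + lam p j) * x \<in> half_open j"
      using j by (simp add: half_open_scaled)
    then show "\<exists>k::int. 2 powi k * x \<in> half_open_set"
      using j(1) unfolding half_open_set_def by blast
  next
    fix k l :: int
    assume "2 powi k * x \<in> half_open_set" "2 powi l * x \<in> half_open_set"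
    then obtain i i' where i: "i \<in> {1..length p}" "2 powi k * x \<in> half_open i"
      and i': "i' \<in> {1..length p}" "2 powi l * x \<in> half_open i'"
      unfolding half_open_set_def by blast
    note cell = i(2)[unfolded half_open_scaled[OF i(1)]]
    note cell' = i'(2)[unfolded half_open_scaled[OF i'(1)]]
    have range: "knot p 0 \<le> breakpoint (j - 1) \<and> breakpoint j \<le> 2 * knot p 0" if "j \<in> {1..length p}" for j
      using that breakpoint_mono_le[of 0 "j - 1"] breakpoint_mono_le[of j "length p"]
      by (auto simp: breakpoint_length breakpoint_def[of 0])
    have dyadic: "knot p 0 \<le> 2 powi (k - lam p i) * x" "2 powi (k - lam p i) * x < 2 * knot p 0"
      "knot p 0 \<le> 2 powi (l - lam p i') * x" "2 powi (l - lam p i') * x < 2 * knot p 0"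
      using cell cell' range[OF i(1)] range[OF i'(1)] by linarith+
    have eq: "k - lam p i = l - lam p i'"
      by (rule dyadic_interval_unique[OF knot_0(1) dyadic])
    then have "i = i'"
      using dyadic_cell[OF dyadic(1,2)] i(1) i'(1) cell cell' by (metis (no_types, lifting))
    with eq show "k = l" by simp
  qed
qed

lemma half_open_set_tile: "translation_dilation_tile half_open_set"
proof
  show "half_open_set \<in> sets lebesgue"
    unfolding half_open_set_def half_open_def by (intro sets.finite_UN sets_completionI_sets) auto
  show "half_open_set \<subseteq> {0<..}"
  proof
    fix x assume "x \<in> half_open_set"
    then obtain j where "j \<in> {1..length p}" "knot p (j - 1) + mul p j \<le> x"
      unfolding half_open_set_def half_open_def by auto
    then show "x \<in> {0<..}" using cell_in_unit(1)[of j] knot_0(1) by simp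
  qed
  show "bounded half_open_set"
    unfolding half_open_set_def half_open_def by (intro bounded_UN) auto
qed (fact half_open_set_translation half_open_set_dilation)+

lemma polygonal_set_positive: "polygonal_set p \<subseteq> {knot p 0..}"
proof
  fix x assume "x \<in> polygonal_set p"
  then obtain j where "j \<in> {1..length p}" "knot p (j - 1) + mul p j \<le> x"
    unfolding polygonal_set_def polygonal_interval_eq by auto
  then show "x \<in> {knot p 0..}" using cell_in_unit(1)[of j] by simp
qed

theorem H2_wavelet_set_polygonal_set: "H2_wavelet_set (polygonal_set p)"
proof (rule translation_dilation_tile.H2_wavelet_set_of_tile[OF half_open_set_tile])
  show "polygonal_set p \<in> sets lebesgue"
    unfolding polygonal_set_def polygonal_interval_eq by (intro sets.finite_UN sets_completionI_sets) auto
  show "polygonal_set p \<subseteq> {0<..}"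
    using polygonal_set_positive knot_0(1) by fastforce
  let ?E = "(\<lambda>j. knot p j + mul p j) ` {1..length p}"
  have "?E \<in> null_sets lebesgue"
    using negligible_finite[of ?E] by (simp add: negligible_iff_null_sets)
  from AE_not_in[OF this]
  show "AE x in lebesgue. x \<in> half_open_set \<longleftrightarrow> x \<in> polygonal_set p"
  proof eventually_elim
    case (elim x)
    then have "x \<in> half_open j \<longleftrightarrow> x \<in> polygonal_interval p j" if "j \<in> {1..length p}" for j
      using that unfolding half_open_def polygonal_interval_eq by (force simp: less_le)
    then show ?case unfolding half_open_set_def polygonal_set_def by auto
  qed
qed

text \<open>For \<open>i < j\<close> the \<open>i\<close>-th piece of the period is to the left of the \<open>j\<close>-th one, so a common point of
the moved pieces forces \<open>m\<^sub>i = m\<^sub>j\<close> or \<open>m\<^sub>i = m\<^sub>j + 1\<close>. In the first case the pieces are adjacent,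
which contradicts \<open>m\<^sub>i \<noteq> m\<^sub>i\<^sub>+\<^sub>1\<close>; in the second one the point is \<open>a\<^sub>0\<close> up to an integer, so that
\<open>i = 1\<close>, which contradicts \<open>m\<^sub>1 = 0\<close>.\<close>

lemma polygonal_intervals_disjoint: "disjoint_family_on (polygonal_interval p) {1..length p}"
proof -
  have not_less: False
    if ij: "i \<in> {1..length p}" "j \<in> {1..length p}" "i < j"
      and x: "x \<in> polygonal_interval p i" "x \<in> polygonal_interval p j" for i j x
  proof -
    have i: "knot p (i - 1) + mul p i \<le> x" "x \<le> knot p i + mul p i"
      and j: "knot p (j - 1) + mul p j \<le> x" "x \<le> knot p j + mul p j"
      using x by (auto simp: polygonal_interval_eq)
    have "knot p i \<le> knot p (j - 1)" using ij by (intro knot_mono_le) auto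
    then have "mul p j \<le> mul p i" using i j by linarith
    moreover have "knot p j - knot p (i - 1) \<le> 1"
      using cell_in_unit[OF ij(1)] cell_in_unit[OF ij(2)] by linarith
    then have "real (mul p i) - real (mul p j) \<le> 1" using i j by linarith
    ultimately consider "mul p i = mul p j" | "mul p i = mul p j + 1" by linarith
    then show False
    proof cases
      case 1
      then have "knot p i = knot p (j - 1)"
        using i j \<open>knot p i \<le> knot p (j - 1)\<close> by simp
      moreover have "knot p i < knot p (j - 1)" if "i \<noteq> j - 1"
        using that ij by (intro knot_mono) auto
      ultimately have "i = j - 1" by fastforce
      then show False using 1 mul_step[of i] ij by auto
    next
      case 2
      then have "knot p (i - 1) = knot p 0"
        using i j cell_in_unit[OF ij(1)] cell_in_unit[OF ij(2)] by simp
      moreover have "knot p 0 < knot p (i - 1)" if "i \<noteq> 1"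
        using that ij by (intro knot_mono) auto
      ultimately have "i = 1" by fastforce
      then show False using 2 mul_1 by simp
    qed
  qed
  show ?thesis
    unfolding disjoint_family_on_def using not_less by (metis disjoint_iff linorder_neqE_nat)
qed

lemma knot_0_in_polygonal_set: "knot p 0 \<in> polygonal_set p"
proof -
  have "knot p 0 \<in> polygonal_interval p 1"
    using knot_mono_le[of 0 1] length_ge_1 mul_1 by (simp add: polygonal_interval_eq)
  then show ?thesis using length_ge_1 unfolding polygonal_set_def by force
qed

text \<open>The set alone thus determines the integer that belongs to a point inside a piece.\<close>

lemma translate_in_polygonal_set:
  assumes "j \<in> {1..length p}" "knot p (j - 1) < t" "t < knot p j"
  shows "t + real m \<in> polygonal_set p \<longleftrightarrow> m = mul p j"
proof
  assume "t + real m \<in> polygonal_set p"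
  then obtain i where i: "i \<in> {1..length p}" "knot p (i - 1) + mul p i \<le> t + m" "t + m \<le> knot p i + mul p i"
    unfolding polygonal_set_def polygonal_interval_eq by auto
  have "real m = real (mul p i)"
  proof -
    have "real m < real (mul p i + 1)" "real (mul p i) < real (m + 1)"
      using i assms cell_in_unit[OF i(1)] cell_in_unit[OF assms(1)] by simp_all
    then show ?thesis unfolding of_nat_less_iff by simp
  qed
  then have "knot p (i - 1) \<le> t" "t \<le> knot p i" using i by auto
  moreover have "i = j"
  proof (cases i j rule: linorder_cases)
    case less
    then have "knot p i \<le> knot p (j - 1)" using assms(1) by (intro knot_mono_le) auto
    then show ?thesis using assms calculation by simp
  next
    case greater
    then have "knot p j \<le> knot p (i - 1)" using i(1) by (intro knot_mono_le) auto
    then show ?thesis using assms calculation by simp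
  qed
  ultimately show "m = mul p j" using \<open>real m = real (mul p i)\<close> by simp
next
  assume "m = mul p j"
  then show "t + real m \<in> polygonal_set p"
    using assms unfolding polygonal_set_def polygonal_interval_eq by (intro UN_I[of j]) auto
qed

end

section \<open>A polygonal is determined by its set\<close>

text \<open>If one sequence had its next knot first, then right after this knot the same set would require
the changed integer \<open>m\<^sub>j\<^sub>+\<^sub>2\<close> for the one and still \<open>m\<^sub>j\<^sub>+\<^sub>1\<close> for the other.\<close>

lemma next_knot_not_less:
  assumes "polygonal p" "polygonal q" and same: "polygonal_set p = polygonal_set q"
    and j: "j < length p" "j < length q" and eq: "knot p 0 = knot q 0" "knot p j = knot q j" "mul p (j + 1) = mul q (j + 1)"
  shows "\<not> knot p (j + 1) < knot q (j + 1)"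
proof
  interpret P: polygonal p by fact
  interpret Q: polygonal q by fact
  assume less: "knot p (j + 1) < knot q (j + 1)"
  also have "\<dots> \<le> knot p (length p)"
    using Q.cell_in_unit(2)[of "j + 1"] j eq(1) by (simp add: P.knot_length)
  finally have "j + 1 \<noteq> length p" by auto
  then have j2: "j + 2 \<le> length p" using j by simp
  then have "knot p (j + 1) < knot p (j + 2)" by (intro P.knot_mono) auto
  then obtain t where t: "knot p (j + 1) < t" "t < knot p (j + 2)" "t < knot q (j + 1)"
    using less dense[of "knot p (j + 1)" "min (knot p (j + 2)) (knot q (j + 1))"] by auto
  have "knot q j < t" using P.knot_step[of j] j t eq by simp
  have "t + real (mul p (j + 2)) \<in> polygonal_set p"
    using P.translate_in_polygonal_set[of "j + 2" t] t j2 by simp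
  then have "mul p (j + 2) = mul q (j + 1)"
    unfolding same using Q.translate_in_polygonal_set[of "j + 1" t] \<open>knot q j < t\<close> t j by simp
  then show False using P.mul_step[of "j + 1"] j2 eq by simp
qed

text \<open>Reading the two sequences from the left, they agree in the minimum \<open>a\<^sub>0\<close> of the set. If they
agree up to the knot \<open>j\<close>, then points just after this knot give the same integer \<open>m\<^sub>j\<^sub>+\<^sub>1\<close>,
\<open>scale_chain\<close> gives the same \<open>\<lambda>\<^sub>j\<^sub>+\<^sub>1\<close>, and the next knots agree, too.\<close>

lemma polygonal_agree:
  assumes "polygonal p" "polygonal q" and same: "polygonal_set p = polygonal_set q"
  shows "j \<le> length p \<Longrightarrow> j \<le> length q \<and> knot p j = knot q j \<and>
     (\<forall>i\<in>{1..j}. lam p i = lam q i \<and> mul p i = mul q i)"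
proof (induction j)
  interpret P: polygonal p by fact
  interpret Q: polygonal q by fact
  have start: "knot p 0 = knot q 0"
    using P.polygonal_set_positive Q.polygonal_set_positive P.knot_0_in_polygonal_set Q.knot_0_in_polygonal_set same
    by (intro antisym) auto
  {
    case 0
    then show ?case using start by simp
  next
    case (Suc j)
    then have IH: "j \<le> length q" "knot p j = knot q j" "\<forall>i\<in>{1..j}. lam p i = lam q i \<and> mul p i = mul q i"
      and jp: "j < length p" by auto
    have "knot q j < knot q (length q)"
      using P.knot_mono[of j "length p"] jp IH(2) start by (simp add: P.knot_length Q.knot_length)
    then have jq: "j < length q" using IH(1) by (cases "j = length q") auto
    obtain t where t: "knot p j < t" "t < knot p (j + 1)" "t < knot q (j + 1)"
      using dense[of "knot p j" "min (knot p (j + 1)) (knot q (j + 1))"]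
        P.knot_step[OF jp] Q.knot_step[OF jq] IH(2) by auto
    have "t + real (mul p (j + 1)) \<in> polygonal_set p"
      using P.translate_in_polygonal_set[of "j + 1" t] t jp by simp
    then have mul: "mul p (j + 1) = mul q (j + 1)"
      unfolding same using Q.translate_in_polygonal_set[of "j + 1" t] t jq IH(2) by simp
    have lam: "lam p (j + 1) = lam q (j + 1)"
    proof (cases "j = 0")
      case True
      then show ?thesis using P.lam_1 Q.lam_1 by simp
    next
      case False
      then have eq_j: "lam p j = lam q j" "mul p j = mul q j" using IH(3) by auto
      have "P.scale j * (knot p j + mul p j) = P.scale (j + 1) * (knot p j + mul p (j + 1))"
        "Q.scale j * (knot q j + mul q j) = Q.scale (j + 1) * (knot q j + mul q (j + 1))"
        using False jp jq P.scale_chain[of j] Q.scale_chain[of j] by auto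
      then have "P.scale (j + 1) * (knot p j + mul p (j + 1)) = Q.scale (j + 1) * (knot p j + mul p (j + 1))"
        using eq_j mul IH(2) by (simp add: P.scale_def Q.scale_def)
      moreover have "knot p j + mul p (j + 1) > 0"
        using P.knot_mono_le[of 0 j] P.knot_0 jp by simp
      ultimately show ?thesis by (simp add: P.scale_def Q.scale_def power_int_2_eq_iff)
    qed
    have "knot p (j + 1) = knot q (j + 1)"
      using next_knot_not_less[OF assms jp jq start IH(2) mul]
        next_knot_not_less[OF assms(2,1) same[symmetric] jq jp start[symmetric] IH(2)[symmetric] mul[symmetric]]
      by simp
    then show ?case
      using jq lam mul IH(3) by (auto simp: le_Suc_eq)
  }
qed

theorem polygonal_set_injective:
  assumes "polygonal p" "polygonal q" and same: "polygonal_set p = polygonal_set q"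
  shows "p = q"
proof (rule nth_equalityI)
  show len: "length p = length q"
    using polygonal_agree[OF assms, of "length p"] polygonal_agree[OF assms(2,1) same[symmetric], of "length q"]
    by simp
  fix i assume "i < length p"
  then have "lam p (i + 1) = lam q (i + 1)" "mul p (i + 1) = mul q (i + 1)"
    using polygonal_agree[OF assms, of "length p"] by auto
  then show "p ! i = q ! i" by (simp add: lam_def mul_def prod_eq_iff)
qed

theorem theorem9:
  "(\<forall>n p. 1 \<le> n \<and> length p = n \<and> H2_MSF_polygonal p \<longrightarrow>
      H2_wavelet_set (polygonal_set p) \<and>
      (\<forall>j\<in>{1..n}. \<exists>u v. u < v \<and> polygonal_interval p j = {u..v}) \<and>
      disjoint_family_on (polygonal_interval p) {1..n}) \<and>
   (\<forall>p q. H2_MSF_polygonal p \<and> H2_MSF_polygonal q \<and> map grid_point p \<noteq> map grid_point q \<longrightarrow>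
      polygonal_set p \<noteq> polygonal_set q)"
proof (intro conjI allI impI)
  fix n p assume "1 \<le> n \<and> length p = n \<and> H2_MSF_polygonal p"
  then interpret polygonal p by unfold_locales simp
  have n: "length p = n" using \<open>1 \<le> n \<and> length p = n \<and> H2_MSF_polygonal p\<close> by simp
  show "H2_wavelet_set (polygonal_set p)" by (rule H2_wavelet_set_polygonal_set)
  show "\<forall>j\<in>{1..n}. \<exists>u v. u < v \<and> polygonal_interval p j = {u..v}"
  proof
    fix j assume "j \<in> {1..n}"
    then have "knot p (j - 1) + mul p j < knot p j + mul p j"
      using knot_mono[of "j - 1" j] n by auto
    then show "\<exists>u v. u < v \<and> polygonal_interval p j = {u..v}"
      unfolding polygonal_interval_eq by blast
  qed
  show "disjoint_family_on (polygonal_interval p) {1..n}"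
    using polygonal_intervals_disjoint n by simp
next
  fix p q assume "H2_MSF_polygonal p \<and> H2_MSF_polygonal q \<and> map grid_point p \<noteq> map grid_point q"
  then show "polygonal_set p \<noteq> polygonal_set q"
    using polygonal_set_injective[of p q] by (auto simp: polygonal_def)
qed

end
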